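(* Let $y_0\in\partial\mathcal{O}$. Suppose the following hold. (H1) There exist a nonzero vector $\xi\in\mathcal{X}$ and a radius $r^\star>0$ such that (a) $h_F(y_0,\xi)=\inf_{v\in F(y_0)}\langle v,\xi\rangle>0$, and (b) setting $y^\star:=y_0+\frac{r^\star}{\|\xi\|}\xi$, one has $B_{r^\star}(y^\star)\cap\partial\mathcal{O}\subseteq\mathcal{S}$, where $\mathcal{S}:=\{y\in\partial\mathcal{O}:\ \mathcal{R}_\rho(y)\cap\mathcal{X}_{\mathrm{free}}=\emptyset\text{ for some }\rho>0\}$. (H2) There exists $r_0>0$ such that $B_r(y_0)\cap\mathcal{X}_{\mathrm{free}}$ is connected for all $0<r<r_0$. Assume additionally that $\mathcal{F}_\rho(y_0)\cap\mathcal{X}_{\mathrm{free}}\neq\emptyset$ and $\mathcal{R}_\rho(y_0)\cap\mathcal{X}_{\mathrm{free}}\neq\emptyset$ for all $\rho>0$. Then $y_0$ is an envelope generator; that is, there exists a sequence $(x_n)\subset E$ with $x_n\to y_0$ and $\rho_{\min}(x_n)\to0$.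
   Context: Setting. $\mathcal{X}\subseteq\mathbb{R}^n$ (state space) is a linear subspace with inner product $\langle\cdot,\cdot\rangle$ and norm $\|\cdot\|$; $B_r(x)=\{y\in\mathcal{X}:\|x-y\|<r\}$. $F:\mathcal{X}\rightrightarrows\mathcal{X}$ is a set-valued map (the admissible velocities $F(x)=\{f(x,u):u\in\mathcal{U}\}$ of a control system) satisfying: (SH1) each $F(x)$ is nonempty and convex, the graph $\{(x,v):v\in F(x)\}$ is closed in $\mathcal{X}^2$, and for each compact $K\subset\mathcal{X}$ there is $M>0$ with $\|v\|\le M$ whenever $x\in K$, $v\in F(x)$; (SH2) there are $\gamma,c>0$ with $\|v\|\le\gamma\|x\|+c$ for all $x\in\mathcal{X}$, $v\in F(x)$; (SH3) for each compact $K\subset\mathcal{X}$ there is $k>0$ with $F(x)\subseteq F(y)+k\|x-y\|\overline{B_1(0)}$ for all $x,y\in K$. The minimal Hamiltonian is $h_F(x,\xi):=\inf_{v\in F(x)}\langle v,\xi\rangle$. The running cost $\psi:\mathcal{X}^2\to(0,\infty)$ is continuous. Obstacles and trajectories. $\mathcal{O}\subset\mathcal{X}$ is a closed set (obstacle), $\mathcal{X}_{\mathrm{free}}:=\mathcal{X}\setminus\mathcal{O}$. $\Pi(x,y)$ is the set of absolutely continuous $\pi:[0,T_\pi]\to\mathcal{X}$ (some $T_\pi\ge0$) with $\dot\pi(t)\in F(\pi(t))$ for a.e. $t$, $\pi(0)=x$, $\pi(T_\pi)=y$, and $\pi(t)\in\overline{\mathcal{X}_{\mathrm{free}}}$ for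 all $t\in[0,T_\pi]$. The cost of $\pi$ is $c_\pi:=\int_0^{T_\pi}\psi(\pi(t),\dot\pi(t))\,dt$. Derived notions. $d_c(x,y):=\inf\{c_\pi:\pi\in\Pi(x,y)\}$ ($=\infty$ if $\Pi(x,y)=\emptyset$); $\mathcal{F}_\rho(x):=\{y\in\mathcal{X}:d_c(x,y)<\rho\}$; $\mathcal{R}_\rho(x):=\{y\in\mathcal{X}:d_c(y,x)<\rho\}$; clearance $\mathrm{clr}(x):=\inf_{y\in\mathcal{O}}d_c(x,y)\in[0,\infty]$. Waves. For $\rho>0$, $W_\rho:=\{x\in\mathcal{X}_{\mathrm{free}}:\mathrm{clr}(x)<\rho\}$. For $x\in\mathcal{X}_{\mathrm{free}}$, $\rho_{\min}(x):=\inf\{\rho>0:x\in\partial W_\rho\}$ and $\rho_{\max}(x):=\sup\{\rho>0:x\in\partial W_\rho\}$, with $\rho_{\min}(x)=\rho_{\max}(x)=\infty$ when $\mathrm{clr}(x)=\infty$. The wave envelope is $E:=\{x\in\mathcal{X}_{\mathrm{free}}:\rho_{\min}(x)<\rho_{\max}(x)\}$. A point $y_0\in\partial\mathcal{O}$ is an envelope generator if there is a sequence $x_n\in E$ with $x_n\to y_0$ and $\rho_{\min}(x_n)\to0$. *)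

theory Defs
  imports "HOL-Analysis.Analysis"
begin

text \<open>
  The state space, a finite-dimensional real inner product space, is a type of class
  \<^class>\<open>euclidean_space\<close>. The data are the set-valued map \<open>F\<close> of admissible velocities, the
  running cost \<open>\<psi>\<close> (a function of the pair position, velocity) and the obstacle \<open>Obs\<close>; the free
  space is \<open>- Obs\<close>. Costs and clearances are extended nonnegative reals, so that an
  infimum over no trajectories is \<open>\<infinity>\<close>.
\<close>

definition SH1 :: "('a::euclidean_space \<Rightarrow> 'a set) \<Rightarrow> bool" where
  "SH1 F \<longleftrightarrow>
     (\<forall>x. F x \<noteq> {} \<and> convex (F x)) \<and>
     closed {(x, v). v \<in> F x} \<and>
     (\<forall>K. compact K \<longrightarrow> (\<exists>M>0. \<forall>x\<in>K. \<forall>v\<in>F x. norm v \<le> M))"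

definition SH2 :: "('a::euclidean_space \<Rightarrow> 'a set) \<Rightarrow> bool" where
  "SH2 F \<longleftrightarrow> (\<exists>\<gamma>>0. \<exists>c>0. \<forall>x. \<forall>v\<in>F x. norm v \<le> \<gamma> * norm x + c)"

definition SH3 :: "('a::euclidean_space \<Rightarrow> 'a set) \<Rightarrow> bool" where
  "SH3 F \<longleftrightarrow>
     (\<forall>K. compact K \<longrightarrow>
        (\<exists>k>0. \<forall>x\<in>K. \<forall>y\<in>K.
           F x \<subseteq> {w + (k * norm (x - y)) *\<^sub>R u | w u. w \<in> F y \<and> u \<in> cball 0 1}))"

definition min_hamiltonian :: "('a::euclidean_space \<Rightarrow> 'a set) \<Rightarrow> 'a \<Rightarrow> 'a \<Rightarrow> real" where
  "min_hamiltonian F x \<xi> = (INF v\<in>F x. v \<bullet> \<xi>)"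

text \<open>
  Absolute continuity on \<open>{a..b}\<close>, in the \<open>\<epsilon>\<close>-\<open>\<delta>\<close> form: \<open>D\<close> ranges over the finite families of
  non-overlapping closed subintervals of \<open>{a..b}\<close>.
\<close>

definition abs_continuous_on_interval :: "real \<Rightarrow> real \<Rightarrow> (real \<Rightarrow> 'a::euclidean_space) \<Rightarrow> bool" where
  "abs_continuous_on_interval a b f \<longleftrightarrow>
     (\<forall>\<epsilon>>0. \<exists>\<delta>>0. \<forall>D. D division_of \<Union>D \<and> \<Union>D \<subseteq> {a..b} \<and> (\<Sum>K\<in>D. Sup K - Inf K) < \<delta> \<longrightarrow>
        (\<Sum>K\<in>D. norm (f (Sup K) - f (Inf K))) < \<epsilon>)"

text \<open>
  A trajectory is a pair \<open>(T, \<pi>)\<close>; only the restriction of \<open>\<pi>\<close> to \<open>{0..T}\<close> matters.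
\<close>

definition trajectories ::
  "('a::euclidean_space \<Rightarrow> 'a set) \<Rightarrow> 'a set \<Rightarrow> 'a \<Rightarrow> 'a \<Rightarrow> (real \<times> (real \<Rightarrow> 'a)) set" where
  "trajectories F Obs x y = {(T, \<pi>).
     T \<ge> 0 \<and> abs_continuous_on_interval 0 T \<pi> \<and>
     (AE t in lebesgue. t \<in> {0..T} \<longrightarrow>
        (\<exists>v\<in>F (\<pi> t). (\<pi> has_vector_derivative v) (at t within {0..T}))) \<and>
     \<pi> 0 = x \<and> \<pi> T = y \<and> (\<forall>t\<in>{0..T}. \<pi> t \<in> closure (- Obs))}"

definition traj_cost ::
  "('a::euclidean_space \<times> 'a \<Rightarrow> real) \<Rightarrow> real \<times> (real \<Rightarrow> 'a) \<Rightarrow> ennreal" where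
  "traj_cost \<psi> = (\<lambda>(T, \<pi>).
     \<integral>\<^sup>+ t\<in>{0..T}. ennreal (\<psi> (\<pi> t, vector_derivative \<pi> (at t within {0..T}))) \<partial>lebesgue)"

definition d_c ::
  "('a::euclidean_space \<Rightarrow> 'a set) \<Rightarrow> ('a \<times> 'a \<Rightarrow> real) \<Rightarrow> 'a set \<Rightarrow> 'a \<Rightarrow> 'a \<Rightarrow> ennreal" where
  "d_c F \<psi> Obs x y = (INF p\<in>trajectories F Obs x y. traj_cost \<psi> p)"

definition forward_reach ::
  "('a::euclidean_space \<Rightarrow> 'a set) \<Rightarrow> ('a \<times> 'a \<Rightarrow> real) \<Rightarrow> 'a set \<Rightarrow> real \<Rightarrow> 'a \<Rightarrow> 'a set" where
  "forward_reach F \<psi> Obs \<rho> x = {y. d_c F \<psi> Obs x y < ennreal \<rho>}"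

definition backward_reach ::
  "('a::euclidean_space \<Rightarrow> 'a set) \<Rightarrow> ('a \<times> 'a \<Rightarrow> real) \<Rightarrow> 'a set \<Rightarrow> real \<Rightarrow> 'a \<Rightarrow> 'a set" where
  "backward_reach F \<psi> Obs \<rho> x = {y. d_c F \<psi> Obs y x < ennreal \<rho>}"

definition clr ::
  "('a::euclidean_space \<Rightarrow> 'a set) \<Rightarrow> ('a \<times> 'a \<Rightarrow> real) \<Rightarrow> 'a set \<Rightarrow> 'a \<Rightarrow> ennreal" where
  "clr F \<psi> Obs x = (INF y\<in>Obs. d_c F \<psi> Obs x y)"

definition wave ::
  "('a::euclidean_space \<Rightarrow> 'a set) \<Rightarrow> ('a \<times> 'a \<Rightarrow> real) \<Rightarrow> 'a set \<Rightarrow> real \<Rightarrow> 'a set" where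
  "wave F \<psi> Obs \<rho> = {x \<in> - Obs. clr F \<psi> Obs x < ennreal \<rho>}"

definition rho_min ::
  "('a::euclidean_space \<Rightarrow> 'a set) \<Rightarrow> ('a \<times> 'a \<Rightarrow> real) \<Rightarrow> 'a set \<Rightarrow> 'a \<Rightarrow> ennreal" where
  "rho_min F \<psi> Obs x =
     (if clr F \<psi> Obs x = \<infinity> then \<infinity>
      else INF \<rho>\<in>{\<rho>. 0 < \<rho> \<and> x \<in> frontier (wave F \<psi> Obs \<rho>)}. ennreal \<rho>)"

definition rho_max ::
  "('a::euclidean_space \<Rightarrow> 'a set) \<Rightarrow> ('a \<times> 'a \<Rightarrow> real) \<Rightarrow> 'a set \<Rightarrow> 'a \<Rightarrow> ennreal" where
  "rho_max F \<psi> Obs x =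
     (if clr F \<psi> Obs x = \<infinity> then \<infinity>
      else SUP \<rho>\<in>{\<rho>. 0 < \<rho> \<and> x \<in> frontier (wave F \<psi> Obs \<rho>)}. ennreal \<rho>)"

definition wave_envelope ::
  "('a::euclidean_space \<Rightarrow> 'a set) \<Rightarrow> ('a \<times> 'a \<Rightarrow> real) \<Rightarrow> 'a set \<Rightarrow> 'a set" where
  "wave_envelope F \<psi> Obs = {x \<in> - Obs. rho_min F \<psi> Obs x < rho_max F \<psi> Obs x}"

definition envelope_generator ::
  "('a::euclidean_space \<Rightarrow> 'a set) \<Rightarrow> ('a \<times> 'a \<Rightarrow> real) \<Rightarrow> 'a set \<Rightarrow> 'a \<Rightarrow> bool" where
  "envelope_generator F \<psi> Obs y0 \<longleftrightarrow>
     y0 \<in> frontier Obs \<and>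
     (\<exists>x :: nat \<Rightarrow> 'a. (\<forall>n. x n \<in> wave_envelope F \<psi> Obs) \<and> x \<longlonglongrightarrow> y0 \<and>
        (\<lambda>n. rho_min F \<psi> Obs (x n)) \<longlonglongrightarrow> 0)"

definition unreachable_boundary ::
  "('a::euclidean_space \<Rightarrow> 'a set) \<Rightarrow> ('a \<times> 'a \<Rightarrow> real) \<Rightarrow> 'a set \<Rightarrow> 'a set" where
  "unreachable_boundary F \<psi> Obs =
     {y \<in> frontier Obs. \<exists>\<rho>>0. backward_reach F \<psi> Obs \<rho> y \<inter> - Obs = {}}"

end

theory Submission
  imports Defs "HOL-Complex_Analysis.Great_Picard"
begin

text \<open>
  Near \<open>y0\<close> every admissible velocity climbs in the direction \<open>\<xi>\<close> at a definite rate. Hence a cheap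
  trajectory that starts at distance \<open>s\<close> from \<open>y0\<close> and has not met the obstacle within a time
  proportional to \<open>s\<close> has entered the tangent ball, where the obstacle boundary cannot be reached
  from free space. So the clearance of a free point near \<open>y0\<close> is either \<open>O(s)\<close> or at least a fixed
  \<open>\<rho>1 > 0\<close>. Both cases occur at every scale: the first on trajectories arriving at \<open>y0\<close>, the second on
  trajectories leaving \<open>y0\<close>. The set of points of small clearance is relatively closed, because
  trajectories of bounded duration are compact; by connectedness it is not open, and at any of its
  non-interior points all the wave fronts with parameter between \<open>O(s)\<close> and \<open>\<rho>1\<close> meet.

  Compactness of trajectories rests on two facts of real analysis: a Lipschitz function of one
  real variable is differentiable almost everywhere, and a bound on the derivative almost everywhere
  bounds the increments.
\<close>

section \<open>Lipschitz functions of one variable\<close>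

text \<open>Near \<open>y0\<close> the speed is at most \<open>M\<close> and the ascent along
  \<open>e\<close> at least \<open>\<eta>\<close>, so displacements \<open>z\<close> satisfy
  \<open>e \<bullet> z \<ge> (\<eta> / M) * norm z\<close>. The constant
  \<open>a = \<eta> / (2 * M)\<close> halves this slope; the spare half pays for starting at
  \<open>x\<close> instead of \<open>y0\<close>. Within radius \<open>2 * r * a\<close> the cone of
  slope \<open>a\<close> lies, apart from its apex, in the tangent ball. The running cost is not
  assumed convex in the velocity, so cost need not be lower semicontinuous along converging
  trajectories. The limit argument therefore controls durations and returns to clearance through the
  bound of cost by \<open>P\<close> times duration. The value \<open>C * s\<close> so obtained is
  crude, but it lies below the threshold \<open>\<rho>1\<close>, and this is what makes a set
  defined by the strict inequality \<open>clr < \<rho>1\<close> relatively closed.\<close>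

lemma emeasure_lebesgue_ball_real:
  fixes c r :: real
  assumes "0 < r"
  shows "emeasure lebesgue (ball c r) = ennreal (2 * r)" "emeasure lebesgue (cball c r) = ennreal (2 * r)"
  using assms by (auto simp: ball_eq_greaterThanLessThan cball_eq_atLeastAtMost)

text \<open>The Vitali theorems speak of balls, while slopes are taken over intervals that contain
  \<open>x\<close> without being centred at it. Each interval becomes a ball about its midpoint, and
  length below \<open>k\<close> keeps it within \<open>ball x k\<close>.\<close>

lemma interval_as_ball:
  fixes a b x :: real
  assumes "a < x" "x < b"
  shows "x \<in> ball ((a + b) / 2) ((b - a) / 2)"
    and "b - a < k \<Longrightarrow> cball ((a + b) / 2) ((b - a) / 2) \<subseteq> ball x k"
    and "(a + b) / 2 + (b - a) / 2 = b" "(a + b) / 2 - (b - a) / 2 = a" "2 * ((b - a) / 2) = b - a"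
proof -
  show mid: "(a + b) / 2 + (b - a) / 2 = b" "(a + b) / 2 - (b - a) / 2 = a"
    by (simp_all add: field_simps)
  show "2 * ((b - a) / 2) = b - a"
    by simp
  show "x \<in> ball ((a + b) / 2) ((b - a) / 2)"
    unfolding ball_eq_greaterThanLessThan mid using assms by simp
  show "cball ((a + b) / 2) ((b - a) / 2) \<subseteq> ball x k" if "b - a < k"
    unfolding ball_eq_greaterThanLessThan cball_eq_atLeastAtMost mid using assms that by auto
qed

text \<open>
  The Vitali theorem is applied twice: to intervals of slope at most \<open>p\<close> inside a tight open superset
  of \<open>E\<close>, and then to intervals of slope at least \<open>q\<close> inside these. Comparing the \<open>f\<close>-measures of the
  two families gives \<open>q\<close> times the measure of \<open>E\<close> at most \<open>p\<close> times it, up to \<open>e\<close>.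
\<close>

lemma negligible_slope_gap:
  fixes f :: "real \<Rightarrow> real"
  assumes mono: "mono f" and cont: "continuous_on UNIV f"
    and E: "E \<in> lmeasurable" and pq: "0 < p" "p < q"
    and lo: "\<And>x d. x \<in> E \<Longrightarrow> 0 < d \<Longrightarrow>
               \<exists>a b. a < x \<and> x < b \<and> b - a < d \<and> f b - f a \<le> p * (b - a)"
    and hi: "\<And>x d. x \<in> E \<Longrightarrow> 0 < d \<Longrightarrow>
               \<exists>a b. a < x \<and> x < b \<and> b - a < d \<and> q * (b - a) \<le> f b - f a"
  shows "negligible E"
proof -
  \<comment> \<open>The Stieltjes measure adds up the increments of \<open>f\<close> over countably
    many disjoint intervals; continuity of \<open>f\<close> makes its value on a closed ball exactly
    the increment across it.\<close>
  define \<nu> where "\<nu> = interval_measure f"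
  have f_le: "\<And>x y. x \<le> y \<Longrightarrow> f x \<le> f y"
    using mono by (auto simp: mono_def)
  have sets_\<nu>[measurable_cong]: "sets \<nu> = sets borel"
    by (simp add: \<nu>_def)
  have \<nu>_cball: "emeasure \<nu> (cball c r) = ennreal (f (c + r) - f (c - r))" if "0 < r" for c r
    using that unfolding \<nu>_def cball_eq_atLeastAtMost
    by (intro emeasure_interval_measure_Icc f_le) (auto simp: cont)
  have bound: "ennreal q * emeasure lebesgue E \<le> ennreal p * (emeasure lebesgue E + ennreal e)"
    if "0 < e" for e
  proof -
    obtain U where U: "open U" "E \<subseteq> U" "U - E \<in> lmeasurable" "emeasure lebesgue (U - E) < ennreal e"
      using sets_lebesgue_outer_open[OF fmeasurableD[OF E] \<open>0 < e\<close>] by blast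
    \<comment> \<open>Open balls, so that their union \<open>V\<close> is open and the second family
      fits into it around every point of \<open>E \<inter> V\<close>.\<close>
    define K where "K = {(c, r). 0 < r \<and> ball c r \<subseteq> U \<and> f (c + r) - f (c - r) \<le> p * (2 * r)}"
    have vit: "\<exists>i. i \<in> K \<and> x \<in> ball (fst i) (snd i) \<and> snd i < d" if x: "x \<in> E" and d: "0 < d" for x d
    proof -
      obtain k where k: "0 < k" "ball x k \<subseteq> U"
        using U x by (meson openE subsetD)
      obtain a b where ab: "a < x" "x < b" "b - a < min d k" "f b - f a \<le> p * (b - a)"
        using lo[OF x, of "min d k"] d k by auto
      note mid = interval_as_ball[OF ab(1,2)]
      have "cball ((a + b) / 2) ((b - a) / 2) \<subseteq> ball x k"
        using ab(3) by (intro mid) simp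
      then have "cball ((a + b) / 2) ((b - a) / 2) \<subseteq> U"
        using k(2) by (rule order_trans)
      then have "((a + b) / 2, (b - a) / 2) \<in> K"
        using ab order_trans[OF ball_subset_cball] unfolding K_def mem_Collect_eq case_prod_conv mid by simp
      then show ?thesis
        using ab(3) d mid(1) ball_subset_cball
        by (intro exI[of _ "((a + b) / 2, (b - a) / 2)"]) (auto simp del: mem_ball mem_cball)
    qed
    obtain C where C: "countable C" "C \<subseteq> K"
      "pairwise (\<lambda>i j. disjnt (ball (fst i) (snd i)) (ball (fst j) (snd j))) C"
      "negligible (E - (\<Union>i\<in>C. ball (fst i) (snd i)))"
      by (rule Vitali_covering_theorem_balls[of E K fst snd, OF vit]) (assumption | rule that)+
    define V where "V = (\<Union>i\<in>C. ball (fst i) (snd i))"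
    define K' where "K' = {(c, r). 0 < r \<and> cball c r \<subseteq> V \<and> q * (2 * r) \<le> f (c + r) - f (c - r)}"
    have vit': "\<exists>i. i \<in> K' \<and> x \<in> cball (fst i) (snd i) \<and> snd i < d" if x: "x \<in> E \<inter> V" and d: "0 < d" for x d
    proof -
      have "open V" by (auto simp: V_def)
      then obtain k where k: "0 < k" "ball x k \<subseteq> V"
        using x by (meson openE IntD2)
      obtain a b where ab: "a < x" "x < b" "b - a < min d k" "q * (b - a) \<le> f b - f a"
        using hi[of x "min d k"] x d k by auto
      note mid = interval_as_ball[OF ab(1,2)]
      have "cball ((a + b) / 2) ((b - a) / 2) \<subseteq> ball x k"
        using ab(3) by (intro mid) simp
      then have "cball ((a + b) / 2) ((b - a) / 2) \<subseteq> V"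
        using k(2) by (rule order_trans)
      then have "((a + b) / 2, (b - a) / 2) \<in> K'"
        using ab unfolding K'_def mem_Collect_eq case_prod_conv mid by simp
      then show ?thesis
        using ab(3) d subsetD[OF ball_subset_cball mid(1)]
        by (intro exI[of _ "((a + b) / 2, (b - a) / 2)"]) (auto simp del: mem_ball mem_cball)
    qed
    have pos: "\<And>i. i \<in> K' \<Longrightarrow> 0 < snd i"
      by (auto simp: K'_def)
    obtain C' where C': "countable C'" "C' \<subseteq> K'"
      "pairwise (\<lambda>i j. disjnt (cball (fst i) (snd i)) (cball (fst j) (snd j))) C'"
      "negligible (E \<inter> V - (\<Union>i\<in>C'. cball (fst i) (snd i)))"
      by (rule Vitali_covering_theorem_cballs[of K' snd "E \<inter> V" fst, OF pos vit']) (assumption | rule that)+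
    define V' where "V' = (\<Union>i\<in>C'. cball (fst i) (snd i))"
    have [measurable]: "V \<in> sets borel" "V' \<in> sets borel"
      using C C' by (auto simp: V_def V'_def intro!: sets.countable_UN'')
    have "V' \<subseteq> V"
      using C' by (force simp: V'_def K'_def)
    have "V \<subseteq> U"
      using C by (force simp: V_def K_def)
    have dis: "disjoint_family_on (\<lambda>i. ball (fst i) (snd i)) C" "disjoint_family_on (\<lambda>i. cball (fst i) (snd i)) C'"
      using C(3) C'(3) by (auto simp: disjoint_family_on_def pairwise_def disjnt_def)
    have "emeasure lebesgue E \<le> emeasure lebesgue (V' \<union> ((E - V) \<union> (E \<inter> V - V')))"
      using C(4) C'(4) by (intro emeasure_mono)
        (auto simp flip: V_def V'_def intro!: sets.Un dest!: negligible_imp_sets)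
    also have "\<dots> = emeasure lebesgue V'"
      using C(4) C'(4) unfolding V_def[symmetric] V'_def[symmetric]
      by (intro emeasure_Un_null_set) (auto simp: negligible_iff_null_sets intro: null_sets.Un)
    finally have "ennreal q * emeasure lebesgue E \<le> ennreal q * emeasure lebesgue V'"
      by (rule mult_left_mono) simp
    also have "\<dots> = (\<integral>\<^sup>+i. ennreal q * emeasure lebesgue (cball (fst i) (snd i)) \<partial>count_space C')"
      unfolding V'_def using C' dis by (simp add: emeasure_UN_countable nn_integral_cmult)
    also have "\<dots> \<le> (\<integral>\<^sup>+i. emeasure \<nu> (cball (fst i) (snd i)) \<partial>count_space C')"
    proof (intro nn_integral_mono)
      fix i assume "i \<in> space (count_space C')"
      then have i: "i \<in> K'" using C' by auto
      then have r: "0 < snd i" by (auto simp: K'_def)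
      have "ennreal q * emeasure lebesgue (cball (fst i) (snd i)) = ennreal (q * (2 * snd i))"
        using r pq by (simp only: emeasure_lebesgue_ball_real ennreal_mult)
      also have "\<dots> \<le> emeasure \<nu> (cball (fst i) (snd i))"
        using i r unfolding \<nu>_cball[OF r] by (intro ennreal_leI) (auto simp: K'_def)
      finally show "ennreal q * emeasure lebesgue (cball (fst i) (snd i)) \<le> emeasure \<nu> (cball (fst i) (snd i))" .
    qed
    also have "\<dots> = emeasure \<nu> V'"
      unfolding V'_def using C' dis by (subst emeasure_UN_countable) (auto simp: sets_\<nu>)
    also have "\<dots> \<le> emeasure \<nu> V"
      using \<open>V' \<subseteq> V\<close> by (intro emeasure_mono) auto
    also have "\<dots> = (\<integral>\<^sup>+i. emeasure \<nu> (ball (fst i) (snd i)) \<partial>count_space C)"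
      unfolding V_def using C dis by (subst emeasure_UN_countable) (auto simp: sets_\<nu>)
    also have "\<dots> \<le> (\<integral>\<^sup>+i. ennreal p * emeasure lebesgue (ball (fst i) (snd i)) \<partial>count_space C)"
    proof (intro nn_integral_mono)
      fix i assume "i \<in> space (count_space C)"
      then have i: "i \<in> K" using C by auto
      then have r: "0 < snd i" by (auto simp: K_def)
      have "emeasure \<nu> (ball (fst i) (snd i)) \<le> emeasure \<nu> (cball (fst i) (snd i))"
        by (intro emeasure_mono) (auto simp: sets_\<nu>)
      also have "\<dots> \<le> ennreal (p * (2 * snd i))"
        using i r unfolding \<nu>_cball[OF r] by (intro ennreal_leI) (auto simp: K_def)
      also have "\<dots> = ennreal p * emeasure lebesgue (ball (fst i) (snd i))"
        using r pq by (simp only: emeasure_lebesgue_ball_real ennreal_mult)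
      finally show "emeasure \<nu> (ball (fst i) (snd i)) \<le> ennreal p * emeasure lebesgue (ball (fst i) (snd i))" .
    qed
    also have "\<dots> = ennreal p * emeasure lebesgue V"
      unfolding V_def using C dis by (simp add: emeasure_UN_countable nn_integral_cmult)
    also have "emeasure lebesgue V \<le> emeasure lebesgue (E \<union> (U - E))"
      using \<open>V \<subseteq> U\<close> U E by (intro emeasure_mono) auto
    also have "\<dots> \<le> emeasure lebesgue E + emeasure lebesgue (U - E)"
      using U E by (intro emeasure_subadditive) auto
    also have "\<dots> \<le> emeasure lebesgue E + ennreal e"
      using U by (intro add_left_mono) simp
    finally show ?thesis
      by (simp add: mult_left_mono)
  qed
  define m where "m = measure lebesgue E"
  have m: "emeasure lebesgue E = ennreal m" "0 \<le> m"
    using E by (auto simp: m_def emeasure_eq_measure2)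
  have "q * m \<le> p * (m + e)" if "0 < e" for e
  proof -
    have "ennreal (q * m) \<le> ennreal (p * (m + e))"
      using bound[OF that] m pq that by (simp add: ennreal_mult)
    then show ?thesis
      using m pq that by (subst (asm) ennreal_le_iff) auto
  qed
  from this[of "e / p" for e] have "q * m \<le> p * m + e" if "0 < e" for e
    using that pq by (simp add: distrib_left)
  then have "q * m \<le> p * m"
    by (rule field_le_epsilon)
  then have "m = 0"
    using pq m by (metis less_eq_real_def mult_le_cancel_right not_less)
  then show ?thesis
    using E by (simp add: m_def negligible_iff_measure)
qed

section \<open>Differentiability almost everywhere of Lipschitz functions\<close>

lemma le_of_le_add_small:
  fixes u v c d :: real
  assumes "0 < d" and le: "\<And>t. 0 < t \<Longrightarrow> t < d \<Longrightarrow> u \<le> v + c * t"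
  shows "u \<le> v"
proof (rule field_le_epsilon)
  fix e :: real assume "0 < e"
  define t where "t = min (d / 2) (e / (\<bar>c\<bar> + 1))"
  have t: "0 < t" "t < d" "t \<le> e / (\<bar>c\<bar> + 1)"
    using \<open>0 < d\<close> \<open>0 < e\<close> by (auto simp: t_def)
  have "c * t \<le> (\<bar>c\<bar> + 1) * t"
    using t by (intro mult_right_mono) auto
  also have "\<dots> \<le> e"
    using t(3) by (simp add: field_simps)
  finally show "u \<le> v + e"
    using le[OF t(1,2)] by simp
qed

text \<open>Slopes are taken over intervals with \<open>x\<close> strictly inside: for fixed
  endpoints this is an open condition on \<open>x\<close>, so \<open>A q n\<close> and
  \<open>B p n\<close> are open and measurability is immediate. Outside \<open>Bad\<close> the
  slopes over shrinking intervals cannot oscillate across a gap between positive rationals, hence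
  they converge; the slope bounds carry the limit over to intervals that end at \<open>x\<close>.
  The lower bound 1 keeps the thresholds positive, as the gap lemma demands.\<close>

lemma bilipschitz_mono_differentiable_ae:
  fixes f :: "real \<Rightarrow> real"
  assumes lower: "\<And>x y. x \<le> y \<Longrightarrow> y - x \<le> f y - f x"
    and upper: "\<And>x y. x \<le> y \<Longrightarrow> f y - f x \<le> M * (y - x)"
  shows "negligible {x. \<not> f differentiable (at x)}"
proof -
  define A where "A q n = {x. \<exists>a b. a < x \<and> x < b \<and> b - a < inverse (Suc n) \<and> q * (b - a) \<le> f b - f a}" for q n
  define B where "B p n = {x. \<exists>a b. a < x \<and> x < b \<and> b - a < inverse (Suc n) \<and> f b - f a \<le> p * (b - a)}" for p n
  define E where "E p q m = ball 0 (real m) \<inter> ((\<Inter>n. A q n) \<inter> (\<Inter>n. B p n))" for p q m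
  have inA: "x \<in> A q n \<longleftrightarrow> (\<exists>a b. a < x \<and> x < b \<and> b - a < inverse (Suc n) \<and> q * (b - a) \<le> f b - f a)" for x q n
    by (simp add: A_def)
  have inB: "x \<in> B p n \<longleftrightarrow> (\<exists>a b. a < x \<and> x < b \<and> b - a < inverse (Suc n) \<and> f b - f a \<le> p * (b - a))" for x p n
    by (simp add: B_def)
  have opens: "open (A q n)" "open (B p n)" for p q n
    unfolding A_def B_def
    by (intro open_Collect_ex open_Collect_conj open_Collect_less open_Collect_const continuous_intros)+
  have "\<bar>f x - f y\<bar> \<le> M * \<bar>x - y\<bar>" for x y
    using upper[of x y] lower[of x y] upper[of y x] lower[of y x] by (cases "x \<le> y") auto
  then have cont: "continuous_on UNIV f"
    using order_trans[OF lower upper, of 0 1]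
    by (intro lipschitz_on_continuous_on[of M]) (auto simp: lipschitz_on_def dist_real_def)
  have mono: "mono f"
    using lower by (intro monoI) force
  have negE: "negligible (E p q m)" if pq: "0 < p" "p < q" for p q m
  proof (rule negligible_slope_gap[OF mono cont _ pq])
    have "E p q m \<in> sets lebesgue"
      unfolding E_def using opens by (auto intro!: sets.Int sets.countable_INT'')
    then show "E p q m \<in> lmeasurable"
      by (rule bounded_set_imp_lmeasurable[rotated]) (auto simp: E_def intro: bounded_subset[OF bounded_ball])
    fix x d :: real assume x: "x \<in> E p q m" and "0 < d"
    then obtain n where n: "inverse (Suc n) < d"
      using reals_Archimedean by auto
    have "x \<in> A q n" "x \<in> B p n"
      using x by (auto simp: E_def)
    then show "\<exists>a b. a < x \<and> x < b \<and> b - a < d \<and> f b - f a \<le> p * (b - a)"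
      and "\<exists>a b. a < x \<and> x < b \<and> b - a < d \<and> q * (b - a) \<le> f b - f a"
      using n unfolding inA inB by (meson less_trans)+
  qed
  define Bad where "Bad = (\<Union>m. \<Union>(p, q)\<in>{(p, q) \<in> \<rat> \<times> \<rat>. 0 < p \<and> p < q}. E p q m)"
  have "countable {(p, q) \<in> \<rat> \<times> \<rat>. 0 < p \<and> p < (q::real)}"
    by (rule countable_subset[of _ "\<rat> \<times> \<rat>"]) (auto simp: countable_rat)
  then have "negligible Bad"
    unfolding Bad_def by (intro negligible_Union_nat negligible_countable_Union) (auto intro: negE)
  moreover have "f differentiable (at x)" if "x \<notin> Bad" for x
  proof -
    define Q where "Q = {q. \<forall>n. x \<in> A q n}"
    have one: "1 \<in> Q"
    proof -
      have "x \<in> A 1 n" for n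
        unfolding inA using lower[of "x - inverse (Suc n) / 3" "x + inverse (Suc n) / 3"]
        by (intro exI[of _ "x - inverse (Suc n) / 3"] exI[of _ "x + inverse (Suc n) / 3"]) auto
      then show ?thesis by (simp add: Q_def)
    qed
    have le_M: "q \<le> M" if "q \<in> Q" for q
    proof -
      have "x \<in> A q 0"
        using that by (simp add: Q_def)
      then obtain a b where "a < x" "x < b" "q * (b - a) \<le> f b - f a"
        unfolding inA by blast
      then show ?thesis
        using upper[of a b] by (smt (verit) mult_le_cancel_right)
    qed
    have bdd: "bdd_above Q"
      using le_M by (auto simp: bdd_above_def)
    have down: "q \<in> Q" if "q' \<in> Q" "q \<le> q'" for q q'
    proof -
      have "\<exists>a b. a < x \<and> x < b \<and> b - a < inverse (Suc n) \<and> q * (b - a) \<le> f b - f a" for n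
      proof -
        obtain a b where ab: "a < x" "x < b" "b - a < inverse (Suc n)" "q' * (b - a) \<le> f b - f a"
          using \<open>q' \<in> Q\<close> unfolding Q_def inA by blast
        moreover have "q * (b - a) \<le> q' * (b - a)"
          using ab \<open>q \<le> q'\<close> by (intro mult_right_mono) auto
        ultimately show ?thesis by (meson order_trans)
      qed
      then show ?thesis unfolding Q_def inA by blast
    qed
    \<comment> \<open>The candidate derivative: the supremum of the slopes reached at every scale.
      Slopes of at least \<open>l + e\<close> therefore stop at some scale.\<close>
    define l where "l = Sup Q"
    have l1: "1 \<le> l"
      unfolding l_def using one bdd by (rule cSup_upper)
    have strad: "\<exists>d>0. \<forall>a b. a < x \<and> x < b \<and> b - a < d \<longrightarrow>
        (l - e) * (b - a) \<le> f b - f a \<and> f b - f a \<le> (l + e) * (b - a)" if "0 < e" for e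
    proof -
      have "l + e \<notin> Q"
        using cSup_upper[OF _ bdd, of "l + e"] \<open>0 < e\<close> by (auto simp: l_def)
      then obtain n where n: "x \<notin> A (l + e) n" by (auto simp: Q_def)
      have "\<exists>m. \<forall>a b. a < x \<and> x < b \<and> b - a < inverse (Suc m) \<longrightarrow> (l - e) * (b - a) \<le> f b - f a"
      \<comment> \<open>A threshold below 1 is settled by \<open>lower\<close>. Otherwise the
        rationals with \<open>l - e < p < q < l\<close> are positive, \<open>q\<close> is reached at
        every scale, and \<open>x \<notin> E p q m\<close> forces all slopes above \<open>p\<close>
        from some scale on.\<close>
      proof (cases "1 \<le> l - e")
        case False
        have "(l - e) * (b - a) \<le> f b - f a" if "a < x" "x < b" for a b
        proof -
          have "(l - e) * (b - a) \<le> 1 * (b - a)"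
            using False that by (intro mult_right_mono) auto
          also have "\<dots> \<le> f b - f a" using lower[of a b] that by simp
          finally show ?thesis .
        qed
        then show ?thesis by blast
      next
        case True
        obtain q where q: "q \<in> \<rat>" "l - e / 2 < q" "q < l"
          using Rats_dense_in_real[of "l - e / 2" l] \<open>0 < e\<close> by auto
        obtain p where p: "p \<in> \<rat>" "l - e < p" "p < q"
          using Rats_dense_in_real[of "l - e" q] \<open>0 < e\<close> q by auto
        obtain q' where "q' \<in> Q" "q < q'"
          using less_cSupD[of Q q] one q by (auto simp: l_def)
        then have "q \<in> Q" using down by auto
        obtain m where "x \<in> ball 0 (real m)"
          using reals_Archimedean2[of "\<bar>x\<bar>"] by (auto simp: dist_real_def)
        moreover have "x \<notin> E p q m"
          using \<open>x \<notin> Bad\<close> p q True by (force simp: Bad_def)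
        ultimately obtain k where k: "x \<notin> B p k"
          using \<open>q \<in> Q\<close> by (auto simp: E_def Q_def)
        have "(l - e) * (b - a) \<le> f b - f a" if "a < x" "x < b" "b - a < inverse (Suc k)" for a b
        proof -
          have "(l - e) * (b - a) \<le> p * (b - a)"
            using p that by (intro mult_right_mono) auto
          then show ?thesis using k that unfolding inB by (smt (verit))
        qed
        then show ?thesis by blast
      qed
      then obtain m where m: "\<And>a b. a < x \<and> x < b \<and> b - a < inverse (Suc m) \<Longrightarrow> (l - e) * (b - a) \<le> f b - f a"
        by blast
      show ?thesis
      proof (intro exI[of _ "min (inverse (Suc m)) (inverse (Suc n))"] conjI allI impI)
        fix a b assume "a < x \<and> x < b \<and> b - a < min (inverse (Suc m)) (inverse (Suc n))"
        then show "(l - e) * (b - a) \<le> f b - f a" "f b - f a \<le> (l + e) * (b - a)"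
          using m n unfolding inA by (auto simp: not_le intro: less_imp_le)
      qed auto
    qed
    have "(f has_derivative (\<lambda>h. l * h)) (at x)"
      unfolding has_derivative_within_alt
    proof (intro conjI allI impI)
      show "bounded_linear ((*) l)" by (rule bounded_linear_mult_right)
      fix e :: real assume "0 < e"
      obtain d where d: "0 < d" "\<And>a b. a < x \<Longrightarrow> x < b \<Longrightarrow> b - a < d \<Longrightarrow>
        (l - e) * (b - a) \<le> f b - f a \<and> f b - f a \<le> (l + e) * (b - a)"
        using strad[OF \<open>0 < e\<close>] by blast
      have "norm (f y - f x - l * (y - x)) \<le> e * norm (y - x)" if y: "norm (y - x) < d" for y
      proof -
        consider "y = x" | "x < y" | "y < x" by linarith
        then show ?thesis
        proof cases
          case 2
          \<comment> \<open>The interval from \<open>x\<close> to \<open>y\<close> does not straddle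
            \<open>x\<close>. It is extended to \<open>x - t\<close>, the change is paid for by the
            slope bounds, and \<open>t\<close> tends to 0; the other side is symmetric.\<close>
          have "f y - f x \<le> (l + e) * (y - x)"
          proof (rule le_of_le_add_small[of "d - (y - x)" _ _ "l + e"])
            fix t assume t: "0 < t" "t < d - (y - x)"
            show "f y - f x \<le> (l + e) * (y - x) + (l + e) * t"
              using d(2)[of "x - t" y] t 2 lower[of "x - t" x] by (simp add: algebra_simps)
          qed (use y 2 in auto)
          moreover have "(l - e) * (y - x) \<le> f y - f x"
          proof (rule le_of_le_add_small[of "d - (y - x)" _ _ "M - (l - e)"])
            fix t assume t: "0 < t" "t < d - (y - x)"
            show "(l - e) * (y - x) \<le> f y - f x + (M - (l - e)) * t"
              using d(2)[of "x - t" y] t 2 upper[of "x - t" x] by (simp add: algebra_simps)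
          qed (use y 2 in auto)
          ultimately show ?thesis
            using 2 by (simp add: abs_le_iff algebra_simps)
        next
          case 3
          have "f x - f y \<le> (l + e) * (x - y)"
          proof (rule le_of_le_add_small[of "d - (x - y)" _ _ "l + e"])
            fix t assume t: "0 < t" "t < d - (x - y)"
            show "f x - f y \<le> (l + e) * (x - y) + (l + e) * t"
              using d(2)[of y "x + t"] t 3 lower[of x "x + t"] by (simp add: algebra_simps)
          qed (use y 3 in auto)
          moreover have "(l - e) * (x - y) \<le> f x - f y"
          proof (rule le_of_le_add_small[of "d - (x - y)" _ _ "M - (l - e)"])
            fix t assume t: "0 < t" "t < d - (x - y)"
            show "(l - e) * (x - y) \<le> f x - f y + (M - (l - e)) * t"
              using d(2)[of y "x + t"] t 3 upper[of x "x + t"] by (simp add: algebra_simps)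
          qed (use y 3 in auto)
          ultimately show ?thesis
            using 3 by (simp add: abs_le_iff algebra_simps)
        qed simp
      qed
      then show "\<exists>d>0. \<forall>y\<in>UNIV. norm (y - x) < d \<longrightarrow> norm (f y - f x - l * (y - x)) \<le> e * norm (y - x)"
        using d(1) by blast
    qed
    then show ?thesis
      by (rule differentiableI)
  qed
  ultimately show ?thesis
    by - (erule negligible_subset, blast)
qed

proposition Lipschitz_differentiable_ae:
  fixes f :: "real \<Rightarrow> 'a::euclidean_space"
  assumes lip: "L-lipschitz_on UNIV f"
  shows "negligible {x. \<not> f differentiable (at x)}"
proof -
  have comp: "negligible {x. \<not> (\<lambda>t. f t \<bullet> i) differentiable (at x)}" if i: "i \<in> Basis" for i
  proof -
    \<comment> \<open>The linear term makes every slope of \<open>g\<close> lie between \<open>1\<close> and \<open>2 * L + 1\<close>.\<close>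
    define g where "g t = f t \<bullet> i + (L + 1) * t" for t
    have "\<bar>f x \<bullet> i - f y \<bullet> i\<bar> \<le> L * \<bar>x - y\<bar>" for x y
      using Basis_le_norm[OF i, of "f x - f y"] lipschitz_onD[OF lip, of x y]
      by (simp add: inner_diff_left dist_norm)
    then have comp_le: "f x \<bullet> i - f y \<bullet> i \<le> L * \<bar>x - y\<bar>" for x y
      by (simp_all add: abs_le_iff)
    have "negligible {x. \<not> g differentiable (at x)}"
    proof (rule bilipschitz_mono_differentiable_ae[where M = "2 * L + 1"])
      fix x y :: real assume "x \<le> y"
      then show "y - x \<le> g y - g x" "g y - g x \<le> (2 * L + 1) * (y - x)"
        using comp_le[of x y] comp_le[of y x] by (simp_all add: g_def algebra_simps)
    qed
    moreover have "(\<lambda>t. f t \<bullet> i) differentiable (at x)" if "g differentiable (at x)" for x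
    proof -
      have "(\<lambda>t. g t - (L + 1) * t) differentiable (at x)"
        using that by (intro differentiable_diff) auto
      then show ?thesis by (simp add: g_def)
    qed
    ultimately show ?thesis
      by - (erule negligible_subset, blast)
  qed
  have "negligible (\<Union>i\<in>Basis. {x. \<not> (\<lambda>t. f t \<bullet> i) differentiable (at x)})"
    by (rule negligible_Union) (simp, erule imageE, simp add: comp)
  moreover have "{x. \<not> f differentiable (at x)} \<subseteq> (\<Union>i\<in>Basis. {x. \<not> (\<lambda>t. f t \<bullet> i) differentiable (at x)})"
    by (subst differentiable_componentwise_within) blast
  ultimately show ?thesis
    by (rule negligible_subset)
qed

section \<open>Absolute continuity\<close>

lemma division_of_real_cases:
  fixes D :: "real set set"
  assumes "D division_of \<Union>D" "K \<in> D"
  obtains c d where "K = {c..d}" "c \<le> d" "Inf K = c" "Sup K = d"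
proof -
  obtain c d where "K = {c..d}" "K \<noteq> {}"
    using division_ofD(3,4)[OF assms(1) assms(2)] by (auto simp: box_real)
  then show ?thesis by (intro that) auto
qed

lemma abs_continuous_on_interval_lipschitz:
  fixes f :: "real \<Rightarrow> 'a::euclidean_space"
  assumes lip: "L-lipschitz_on {a..b} f"
  shows "abs_continuous_on_interval a b f"
  unfolding abs_continuous_on_interval_def
proof (intro allI impI)
  fix \<epsilon> :: real assume "0 < \<epsilon>"
  have L: "0 \<le> L" using lip by (rule lipschitz_on_nonneg)
  show "\<exists>\<delta>>0. \<forall>D. D division_of \<Union>D \<and> \<Union>D \<subseteq> {a..b} \<and> (\<Sum>K\<in>D. Sup K - Inf K) < \<delta> \<longrightarrow>
        (\<Sum>K\<in>D. norm (f (Sup K) - f (Inf K))) < \<epsilon>"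
  proof (intro exI[of _ "\<epsilon> / (L + 1)"] conjI allI impI)
    show "0 < \<epsilon> / (L + 1)" using L \<open>0 < \<epsilon>\<close> by simp
    fix D assume D: "D division_of \<Union>D \<and> \<Union>D \<subseteq> {a..b} \<and> (\<Sum>K\<in>D. Sup K - Inf K) < \<epsilon> / (L + 1)"
    have K: "0 \<le> Sup K - Inf K \<and> norm (f (Sup K) - f (Inf K)) \<le> L * (Sup K - Inf K)" if "K \<in> D" for K
    proof -
      obtain c d where cd: "K = {c..d}" "c \<le> d" "Inf K = c" "Sup K = d"
        using D \<open>K \<in> D\<close> by (meson division_of_real_cases)
      have "K \<subseteq> {a..b}" using D that by blast
      then have "{c, d} \<subseteq> {a..b}" using cd by auto
      then have "norm (f d - f c) \<le> L * \<bar>d - c\<bar>"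
        using lipschitz_onD[OF lip, of d c] by (auto simp: dist_norm)
      then show ?thesis using cd by auto
    qed
    have "(\<Sum>K\<in>D. norm (f (Sup K) - f (Inf K))) \<le> L * (\<Sum>K\<in>D. Sup K - Inf K)"
      unfolding sum_distrib_left using K by (intro sum_mono) auto
    also have "\<dots> \<le> (L + 1) * (\<Sum>K\<in>D. Sup K - Inf K)"
      using K by (intro mult_right_mono sum_nonneg) auto
    also have "\<dots> < \<epsilon>"
      using D L by (simp add: field_simps)
    finally show "(\<Sum>K\<in>D. norm (f (Sup K) - f (Inf K))) < \<epsilon>" .
  qed
qed

lemma abs_continuous_on_interval_subset:
  assumes "abs_continuous_on_interval a b f" "{c..d} \<subseteq> {a..b}"
  shows "abs_continuous_on_interval c d f"
  using assms unfolding abs_continuous_on_interval_def by (meson order_trans)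

lemma abs_continuous_on_interval_imp_continuous:
  fixes f :: "real \<Rightarrow> 'a::euclidean_space"
  assumes ac: "abs_continuous_on_interval a b f"
  shows "continuous_on {a..b} f"
  unfolding continuous_on_iff
proof (intro ballI allI impI)
  fix x e :: real assume x: "x \<in> {a..b}" and "0 < e"
  obtain d where d: "0 < d" and D: "\<And>D. D division_of \<Union>D \<and> \<Union>D \<subseteq> {a..b} \<and> (\<Sum>K\<in>D. Sup K - Inf K) < d \<Longrightarrow>
        (\<Sum>K\<in>D. norm (f (Sup K) - f (Inf K))) < e"
    using ac \<open>0 < e\<close> unfolding abs_continuous_on_interval_def by blast
  have *: "norm (f t - f s) < e" if "s \<in> {a..b}" "t \<in> {a..b}" "s \<le> t" "t - s < d" for s t
  proof -
    have "{{s..t}} division_of \<Union>{{s..t}}"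
      using division_of_self[of s t] that by auto
    then show ?thesis
      using D[of "{{s..t}}"] that by auto
  qed
  show "\<exists>d>0. \<forall>x'\<in>{a..b}. dist x' x < d \<longrightarrow> dist (f x') (f x) < e"
  proof (intro exI[of _ d] conjI ballI impI d)
    fix y assume y: "y \<in> {a..b}" "dist y x < d"
    then show "dist (f y) (f x) < e"
      using *[of x y] *[of y x] x by (cases "x \<le> y") (auto simp: dist_norm norm_minus_commute)
  qed
qed

text \<open>Gauges produce tagged cells, absolute continuity speaks of sets of intervals. A cell can
  carry two tags only if it is a single point, because distinct pairs have disjoint interiors, and
  there \<open>g\<close> vanishes.\<close>

lemma sum_tagged_eq_sum_division:
  fixes g :: "real set \<Rightarrow> real"
  assumes p: "p tagged_partial_division_of i"
    and deg: "\<And>c. g {c} = 0"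
  shows "(\<Sum>(x, K)\<in>p. g K) = (\<Sum>K\<in>snd ` p. g K)"
proof -
  have "(\<Sum>K\<in>snd ` p. g K) = sum (g \<circ> snd) p"
  proof (rule sum.reindex_nontrivial)
    show "finite p" using p by (rule tagged_partial_division_ofD)
    fix u v assume uv: "u \<in> p" "v \<in> p" "u \<noteq> v" "snd u = snd v"
    obtain x K y where [simp]: "u = (x, K)" "v = (y, K)"
      using uv by (metis prod.collapse)
    have "interior K \<inter> interior K = {}"
      using tagged_partial_division_ofD(5)[OF p] uv by fastforce
    moreover obtain c d where "K = {c..d}" "x \<in> K"
      using tagged_partial_division_ofD(2,4)[OF p, of x K] uv by (auto simp: box_real)
    ultimately have "K = {c}" by auto
    then show "g (snd u) = 0" by (simp add: deg)
  qed
  also have "\<dots> = (\<Sum>(x, K)\<in>p. g K)"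
    by (intro sum.cong) auto
  finally show ?thesis by simp
qed

text \<open>A gauge argument replaces integration of the derivative. At tags outside
  \<open>N\<close> the gauge makes each increment close to derivative times length; at tags in
  \<open>N\<close> it confines the cells to an open set of small measure, where absolute continuity
  makes the total increment small.\<close>

proposition abs_continuous_increment_le:
  fixes f :: "real \<Rightarrow> 'a::euclidean_space"
  assumes ac: "abs_continuous_on_interval a b f" and N: "negligible N" and "a \<le> b"
    and deriv: "\<And>t. t \<in> {a..b} - N \<Longrightarrow>
      \<exists>v. (f has_vector_derivative v) (at t within {a..b}) \<and> w \<bullet> v \<le> c"
  shows "w \<bullet> (f b - f a) \<le> c * (b - a)"
proof (rule le_of_le_add_small[where d = 1])
  show "(0::real) < 1" by simp
  fix \<epsilon> :: real assume "0 < \<epsilon>" "\<epsilon> < 1"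
  obtain \<delta>0 where \<delta>0: "0 < \<delta>0"
    and AC: "\<And>D. D division_of \<Union>D \<and> \<Union>D \<subseteq> {a..b} \<and> (\<Sum>K\<in>D. Sup K - Inf K) < \<delta>0 \<Longrightarrow>
        (\<Sum>K\<in>D. norm (f (Sup K) - f (Inf K))) < \<epsilon>"
    using ac \<open>0 < \<epsilon>\<close> unfolding abs_continuous_on_interval_def by blast
  \<comment> \<open>The bound \<open>\<delta>0\<close> serves absolute continuity; the bound
    \<open>\<epsilon>\<close> also makes the term \<open>c * (Sup K - Inf K)\<close> small in total
    over the cells tagged in \<open>N\<close>.\<close>
  define \<delta> where "\<delta> = min \<delta>0 \<epsilon>"
  have \<delta>: "0 < \<delta>" "\<delta> \<le> \<delta>0" "\<delta> \<le> \<epsilon>" using \<delta>0 \<open>0 < \<epsilon>\<close> by (auto simp: \<delta>_def)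
  obtain U where U: "open U" "N \<subseteq> U" "U - N \<in> lmeasurable" "emeasure lebesgue (U - N) < ennreal \<delta>"
    using sets_lebesgue_outer_open[OF negligible_imp_sets[OF N] \<delta>(1)] by blast
  have Um: "U \<in> lmeasurable" "measure lebesgue U < \<delta>"
  proof -
    have "U = (U - N) \<union> N" using U by auto
    then show "U \<in> lmeasurable"
      using U(3) N by (metis fmeasurable.Un negligible_imp_measurable)
    have "measure lebesgue U = measure lebesgue ((U - N) \<union> N)"
      using \<open>U = (U - N) \<union> N\<close> by simp
    also have "\<dots> \<le> measure lebesgue (U - N) + measure lebesgue N"
      using U N by (intro measure_Un_le) (auto dest: negligible_imp_sets)
    also have "\<dots> < \<delta>"
      using U(3,4) N \<delta>(1) by (simp add: negligible_imp_measure0 emeasure_eq_measure2 ennreal_less_iff)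
    finally show "measure lebesgue U < \<delta>" .
  qed
  have "\<exists>v d. t \<in> {a..b} - N \<longrightarrow> w \<bullet> v \<le> c \<and> 0 < d \<and>
      (\<forall>y\<in>{a..b}. \<bar>y - t\<bar> < d \<longrightarrow> norm (f y - f t - (y - t) *\<^sub>R v) \<le> \<epsilon> * \<bar>y - t\<bar>)" for t
  proof (cases "t \<in> {a..b} - N")
    case True
    then obtain v where v: "(f has_vector_derivative v) (at t within {a..b})" "w \<bullet> v \<le> c"
      using deriv by blast
    then show ?thesis
      using \<open>0 < \<epsilon>\<close> unfolding has_vector_derivative_def has_derivative_within_alt by fastforce
  qed auto
  then obtain v d where vd: "\<And>t. t \<in> {a..b} - N \<Longrightarrow> w \<bullet> v t \<le> c \<and> 0 < d t \<and>
      (\<forall>y\<in>{a..b}. \<bar>y - t\<bar> < d t \<longrightarrow> norm (f y - f t - (y - t) *\<^sub>R v t) \<le> \<epsilon> * \<bar>y - t\<bar>)"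
    by metis
  define \<gamma> where "\<gamma> t = (if t \<in> N then U else if t \<in> {a..b} then ball t (d t) else UNIV)" for t
  have "gauge \<gamma>"
    using U vd by (auto simp: \<gamma>_def gauge_def)
  then obtain p where p: "p tagged_division_of {a..b}" "\<gamma> fine p"
    using fine_division_exists_real by blast
  note fin = tagged_division_ofD(1)[OF p(1)]
  define pN where "pN = {(x, K) \<in> p. x \<in> N}"
  define pG where "pG = {(x, K) \<in> p. x \<notin> N}"
  have split: "p = pG \<union> pN" "pG \<inter> pN = {}" "finite pG" "finite pN"
    using fin by (auto simp: pN_def pG_def intro: finite_subset[OF _ fin])
  have cell: "\<exists>l u. K = {l..u} \<and> l \<le> x \<and> x \<le> u \<and> a \<le> l \<and> u \<le> b \<and> Inf K = l \<and> Sup K = u" if xK: "(x, K) \<in> p" for x K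
  proof -
    obtain l u where lu: "K = {l..u}"
      using tagged_division_ofD(4)[OF p(1) xK] by (auto simp: box_real)
    moreover have "x \<in> K" "K \<subseteq> {a..b}"
      using tagged_division_ofD(2,3)[OF p(1) xK] by auto
    ultimately show ?thesis
      by (intro exI[of _ l] exI[of _ u]) auto
  qed
  have total: "(\<Sum>(x, K)\<in>p. Sup K - Inf K) = b - a"
    using additive_tagged_division_1[OF \<open>a \<le> b\<close> p(1), of "\<lambda>x. x"] by simp
  have pNd: "pN tagged_partial_division_of {a..b}"
    using p(1) by (auto simp: pN_def tagged_division_of_def intro: tagged_partial_division_subset)
  define D where "D = snd ` pN"
  have Ddiv: "D division_of \<Union>D"
    unfolding D_def by (rule partial_division_of_tagged_division[OF pNd])
  have Dsub: "\<Union>D \<subseteq> {a..b} \<inter> U"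
    using p(2) tagged_division_ofD(3)[OF p(1)] by (force simp: D_def pN_def fine_def \<gamma>_def)
  have len: "(\<Sum>K\<in>D. Sup K - Inf K) < \<delta>"
  proof -
    have "(\<Sum>K\<in>D. Sup K - Inf K) = sum (measure lebesgue) D"
      using Ddiv by (intro sum.cong refl) (auto elim: division_of_real_cases)
    also have "\<dots> = measure lebesgue (\<Union>D)"
      using content_division[OF Ddiv] by simp
    also have "\<dots> \<le> measure lebesgue U"
      using Dsub Um fmeasurableD[OF lmeasurable_division[OF Ddiv]] by (intro measure_mono_fmeasurable) auto
    finally show ?thesis using Um by simp
  qed
  have lenN: "(\<Sum>(x, K)\<in>pN. Sup K - Inf K) < \<delta>"
    unfolding D_def[symmetric] using sum_tagged_eq_sum_division[OF pNd, of "\<lambda>K. Sup K - Inf K"] len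
    by (simp add: D_def)
  have varN: "(\<Sum>(x, K)\<in>pN. norm (f (Sup K) - f (Inf K))) < \<epsilon>"
    using sum_tagged_eq_sum_division[OF pNd, of "\<lambda>K. norm (f (Sup K) - f (Inf K))"]
      AC[of D] Ddiv Dsub len \<delta> by (simp add: D_def)
  have "w \<bullet> (f b - f a) - c * (b - a) = (\<Sum>(x, K)\<in>p. w \<bullet> (f (Sup K) - f (Inf K)) - c * (Sup K - Inf K))"
    unfolding total[symmetric] additive_tagged_division_1[OF \<open>a \<le> b\<close> p(1), of f, symmetric]
    by (simp only: inner_sum_right sum_distrib_left sum_subtractf[symmetric] case_prod_unfold)
  also have "\<dots> = (\<Sum>(x, K)\<in>pG. w \<bullet> (f (Sup K) - f (Inf K)) - c * (Sup K - Inf K))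
      + (\<Sum>(x, K)\<in>pN. w \<bullet> (f (Sup K) - f (Inf K)) - c * (Sup K - Inf K))"
    using split by (simp add: sum.union_disjoint)
  also have "(\<Sum>(x, K)\<in>pG. w \<bullet> (f (Sup K) - f (Inf K)) - c * (Sup K - Inf K))
      \<le> (\<Sum>(x, K)\<in>pG. norm w * \<epsilon> * (Sup K - Inf K))"
  proof (rule sum_mono, clarify)
    fix x K assume xK: "(x, K) \<in> pG"
    then have "(x, K) \<in> p" "x \<notin> N" by (auto simp: pG_def)
    from cell[OF this(1)] obtain l u where lu: "K = {l..u}" "l \<le> x" "x \<le> u" "a \<le> l" "u \<le> b" "Inf K = l" "Sup K = u"
      by blast
    have x: "x \<in> {a..b} - N" using lu \<open>x \<notin> N\<close> by auto
    have "K \<subseteq> ball x (d x)"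
      using p(2) \<open>(x, K) \<in> p\<close> x by (force simp: fine_def \<gamma>_def)
    then have "\<bar>l - x\<bar> < d x" "\<bar>u - x\<bar> < d x"
      using lu subsetD[of K "ball x (d x)" l] subsetD[of K "ball x (d x)" u] by (auto simp: dist_real_def)
    moreover have "l \<in> {a..b}" "u \<in> {a..b}" using lu by auto
    ultimately have "norm (f l - f x - (l - x) *\<^sub>R v x) \<le> \<epsilon> * \<bar>l - x\<bar>"
      "norm (f u - f x - (u - x) *\<^sub>R v x) \<le> \<epsilon> * \<bar>u - x\<bar>"
      using vd[OF x] by blast+
    then have "norm (f l - f x - (l - x) *\<^sub>R v x) \<le> \<epsilon> * (x - l)"
      "norm (f u - f x - (u - x) *\<^sub>R v x) \<le> \<epsilon> * (u - x)"
      using lu by simp_all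
    \<comment> \<open>The tag lies between \<open>l\<close> and \<open>u\<close>, so the errors of
      the two expansions at \<open>x\<close> add up to a multiple of \<open>u - l\<close> itself;
      this is what makes them summable over the division.\<close>
    then have "norm ((f u - f x - (u - x) *\<^sub>R v x) - (f l - f x - (l - x) *\<^sub>R v x)) \<le> \<epsilon> * (u - l)"
      by (intro order_trans[OF norm_triangle_ineq4]) (simp add: algebra_simps)
    also have "(f u - f x - (u - x) *\<^sub>R v x) - (f l - f x - (l - x) *\<^sub>R v x) = f u - f l - (u - l) *\<^sub>R v x"
      by (simp add: algebra_simps)
    finally have "w \<bullet> (f u - f l - (u - l) *\<^sub>R v x) \<le> norm w * (\<epsilon> * (u - l))"
      by (intro order_trans[OF norm_cauchy_schwarz] mult_left_mono) auto
    moreover have "(u - l) * (w \<bullet> v x) \<le> (u - l) * c"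
      using vd[OF x] lu by (intro mult_left_mono) auto
    ultimately show "w \<bullet> (f (Sup K) - f (Inf K)) - c * (Sup K - Inf K) \<le> norm w * \<epsilon> * (Sup K - Inf K)"
      using lu by (simp add: inner_diff_right algebra_simps)
  qed
  also have "\<dots> \<le> (\<Sum>(x, K)\<in>p. norm w * \<epsilon> * (Sup K - Inf K))"
    using cell \<open>0 < \<epsilon>\<close> split by (intro sum_mono2 fin) (fastforce intro!: mult_nonneg_nonneg)+
  also have "\<dots> = norm w * \<epsilon> * (b - a)"
    unfolding total[symmetric] by (simp add: sum_distrib_left case_prod_unfold)
  also have "(\<Sum>(x, K)\<in>pN. w \<bullet> (f (Sup K) - f (Inf K)) - c * (Sup K - Inf K))
      \<le> (\<Sum>(x, K)\<in>pN. norm w * norm (f (Sup K) - f (Inf K)) + \<bar>c\<bar> * (Sup K - Inf K))"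
  proof (rule sum_mono, clarify)
    fix x K assume "(x, K) \<in> pN"
    then have "0 \<le> Sup K - Inf K"
      using cell[of x K] by (auto simp: pN_def)
    then have "- c * (Sup K - Inf K) \<le> \<bar>c\<bar> * (Sup K - Inf K)"
      by (intro mult_right_mono) auto
    then show "w \<bullet> (f (Sup K) - f (Inf K)) - c * (Sup K - Inf K)
        \<le> norm w * norm (f (Sup K) - f (Inf K)) + \<bar>c\<bar> * (Sup K - Inf K)"
      using norm_cauchy_schwarz[of w "f (Sup K) - f (Inf K)"] by simp
  qed
  also have "\<dots> = norm w * (\<Sum>(x, K)\<in>pN. norm (f (Sup K) - f (Inf K))) + \<bar>c\<bar> * (\<Sum>(x, K)\<in>pN. Sup K - Inf K)"
    by (simp add: sum.distrib sum_distrib_left case_prod_unfold)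
  also have "\<dots> \<le> norm w * \<epsilon> + \<bar>c\<bar> * \<epsilon>"
    using varN lenN \<delta> by (intro add_mono mult_left_mono) auto
  finally show "w \<bullet> (f b - f a) \<le> c * (b - a) + (norm w * (b - a) + norm w + \<bar>c\<bar>) * \<epsilon>"
    by (simp add: algebra_simps)
qed

section \<open>Trajectories near a point with positive Hamiltonian\<close>

lemma first_exit_time:
  fixes g :: "real \<Rightarrow> real"
  assumes g: "continuous_on {a..b} g" and "g a < R" and t: "t \<in> {a..b}" "R \<le> g t"
  obtains t1 where "a < t1" "t1 \<le> b" "g t1 = R" "\<And>s. s \<in> {a..t1} \<Longrightarrow> g s \<le> R"
proof -
  define S where "S = {t \<in> {a..b}. g t = R}"
  have crossing: "\<exists>u\<in>S. u \<le> s" if s: "s \<in> {a..b}" "R \<le> g s" for s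
  proof -
    have "\<exists>u\<ge>a. u \<le> s \<and> g u = R"
      using s \<open>g a < R\<close> by (intro IVT') (auto intro: continuous_on_subset[OF g])
    then show ?thesis using s by (auto simp: S_def)
  qed
  have "S \<noteq> {}"
    using crossing[OF t] by auto
  moreover have "compact S"
    using continuous_closed_preimage_constant[OF g, of R] unfolding compact_eq_bounded_closed
    by (auto simp: S_def intro: bounded_subset[OF bounded_closed_interval])
  ultimately obtain t1 where t1: "t1 \<in> S" "\<And>u. u \<in> S \<Longrightarrow> t1 \<le> u"
    using compact_attains_inf[of S] by auto
  show ?thesis
  proof
    show "a < t1" "t1 \<le> b" "g t1 = R"
      using t1(1) \<open>g a < R\<close> by (auto simp: S_def less_le)
    show "g s \<le> R" if s: "s \<in> {a..t1}" for s
    proof (rule ccontr)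
      assume "\<not> g s \<le> R"
      then obtain u where "u \<in> S" "u \<le> s"
        using crossing[of s] s t1(1) by (auto simp: S_def)
      then have "s = t1" using t1(2)[of u] that by auto
      then show False using \<open>\<not> g s \<le> R\<close> t1(1) by (auto simp: S_def)
    qed
  qed
qed

lemma last_entry_time:
  fixes g :: "real \<Rightarrow> real"
  assumes g: "continuous_on {a..b} g" and "g b < R" and t: "t \<in> {a..b}" "R \<le> g t"
  obtains t1 where "a \<le> t1" "t1 < b" "g t1 = R" "\<And>s. s \<in> {t1..b} \<Longrightarrow> g s \<le> R"
proof -
  have "continuous_on {- b..- a} (\<lambda>t. g (- t))"
    by (intro continuous_on_compose2[OF g] continuous_intros) auto
  then obtain t1 where t1: "- b < t1" "t1 \<le> - a" "g (- t1) = R" "\<And>s. s \<in> {- b..t1} \<Longrightarrow> g (- s) \<le> R"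
    using first_exit_time[of "- b" "- a" "\<lambda>t. g (- t)" R "- t"] assms by auto
  show ?thesis
  proof (rule that[of "- t1"])
    show "g s \<le> R" if "s \<in> {- t1..b}" for s
      using t1(4)[of "- s"] that by auto
  qed (use t1 in auto)
qed

lemma trajectories_iff:
  "(T, \<pi>) \<in> trajectories F Obs x y \<longleftrightarrow>
     0 \<le> T \<and> abs_continuous_on_interval 0 T \<pi> \<and>
     (\<exists>N. negligible N \<and>
        (\<forall>t\<in>{0..T} - N. \<exists>v\<in>F (\<pi> t). (\<pi> has_vector_derivative v) (at t within {0..T}))) \<and>
     \<pi> 0 = x \<and> \<pi> T = y \<and> (\<forall>t\<in>{0..T}. \<pi> t \<in> closure (- Obs))"
proof -
  have "(AE t in lebesgue. Q t) \<longleftrightarrow> (\<exists>N. negligible N \<and> (\<forall>t. t \<notin> N \<longrightarrow> Q t))" for Q :: "real \<Rightarrow> bool"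
    unfolding eventually_ae_filter negligible_iff_null_sets by auto
  then have "(AE t in lebesgue. t \<in> {0..T} \<longrightarrow> (\<exists>v\<in>F (\<pi> t). (\<pi> has_vector_derivative v) (at t within {0..T}))) \<longleftrightarrow>
    (\<exists>N. negligible N \<and>
        (\<forall>t\<in>{0..T} - N. \<exists>v\<in>F (\<pi> t). (\<pi> has_vector_derivative v) (at t within {0..T})))"
    by (simp only:) blast
  then show ?thesis
    unfolding trajectories_def by simp
qed

text \<open>The single device for passing from velocities to positions. The test vector
  \<open>- e\<close> yields the ascent, the direction of the displacement yields the speed bound,
  and the negated normal of a separating hyperplane serves the limit argument.\<close>

lemma trajectory_increment_le:
  assumes traj: "(T, \<pi>) \<in> trajectories F Obs x y" and su: "0 \<le> s" "s \<le> u" "u \<le> T"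
    and vel: "\<And>t v. t \<in> {s..u} \<Longrightarrow> v \<in> F (\<pi> t) \<Longrightarrow> w \<bullet> v \<le> c"
  shows "w \<bullet> (\<pi> u - \<pi> s) \<le> c * (u - s)"
proof -
  obtain N where N: "negligible N" "\<And>t. t \<in> {0..T} - N \<Longrightarrow> \<exists>v\<in>F (\<pi> t). (\<pi> has_vector_derivative v) (at t within {0..T})"
    and ac: "abs_continuous_on_interval 0 T \<pi>"
    using traj unfolding trajectories_iff by blast
  have ac': "abs_continuous_on_interval s u \<pi>"
    using ac su by (intro abs_continuous_on_interval_subset[OF ac]) auto
  show ?thesis
  proof (rule abs_continuous_increment_le[OF ac' N(1) su(2)])
    fix t assume t: "t \<in> {s..u} - N"
    then obtain v where "v \<in> F (\<pi> t)" "(\<pi> has_vector_derivative v) (at t within {0..T})"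
      using N(2)[of t] su by auto
    then show "\<exists>v. (\<pi> has_vector_derivative v) (at t within {s..u}) \<and> w \<bullet> v \<le> c"
      using vel t su by (intro exI[of _ v]) (auto intro: has_vector_derivative_within_subset)
  qed
qed

text \<open>Inside \<open>cball y0 \<delta>\<close> displacement, duration and cost are mutually
  comparable: \<open>M\<close> and \<open>\<eta>\<close> relate displacement to duration,
  \<open>m\<close> and \<open>P\<close> relate duration to cost.\<close>

locale local_control_bounds =
  fixes F :: "'a::euclidean_space \<Rightarrow> 'a set" and \<psi> :: "'a \<times> 'a \<Rightarrow> real" and Obs :: "'a set"
    and y0 e :: 'a and \<delta> M \<eta> m P :: real
  assumes pos: "0 < \<delta>" "0 < M" "0 < \<eta>" "0 < m" "0 < P"
    and speed: "\<And>x v. x \<in> cball y0 \<delta> \<Longrightarrow> v \<in> F x \<Longrightarrow> norm v \<le> M"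
    and ascent: "\<And>x v. x \<in> cball y0 \<delta> \<Longrightarrow> v \<in> F x \<Longrightarrow> \<eta> \<le> e \<bullet> v"
    and running_cost: "\<And>x v. x \<in> cball y0 \<delta> \<Longrightarrow> norm v \<le> M \<Longrightarrow> m \<le> \<psi> (x, v) \<and> \<psi> (x, v) \<le> P"
    and norm_e: "norm e = 1"
    and closed_Obs: "closed Obs"
begin

section \<open>Displacement, duration and cost of a segment near \<open>y0\<close>\<close>

lemma segment_increment:
  assumes traj: "(T, \<pi>) \<in> trajectories F Obs x y" and su: "0 \<le> s" "s \<le> u" "u \<le> T"
    and near: "\<And>t. t \<in> {s..u} \<Longrightarrow> \<pi> t \<in> cball y0 \<delta>"
  shows "norm (\<pi> u - \<pi> s) \<le> M * (u - s)" "\<eta> * (u - s) \<le> e \<bullet> (\<pi> u - \<pi> s)"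
proof -
  have *: "w \<bullet> (\<pi> u - \<pi> s) \<le> c * (u - s)"
    if "\<And>x v. x \<in> cball y0 \<delta> \<Longrightarrow> v \<in> F x \<Longrightarrow> w \<bullet> v \<le> c" for w c
    using that near by (intro trajectory_increment_le[OF traj su]) blast
  have "(- e) \<bullet> (\<pi> u - \<pi> s) \<le> (- \<eta>) * (u - s)"
    using ascent by (intro *) auto
  then show "\<eta> * (u - s) \<le> e \<bullet> (\<pi> u - \<pi> s)" by simp
  define w where "w = sgn (\<pi> u - \<pi> s)"
  have "w \<bullet> v \<le> M" if "x \<in> cball y0 \<delta>" "v \<in> F x" for x v
  proof -
    have "w \<bullet> v \<le> norm w * norm v" by (rule norm_cauchy_schwarz)
    also have "\<dots> \<le> 1 * M"
      using speed[OF that] by (intro mult_mono) (auto simp: w_def norm_sgn)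
    finally show ?thesis by simp
  qed
  then have "w \<bullet> (\<pi> u - \<pi> s) \<le> M * (u - s)" by (rule *)
  moreover have "w \<bullet> (\<pi> u - \<pi> s) = norm (\<pi> u - \<pi> s)"
    by (cases "\<pi> u = \<pi> s") (simp_all add: w_def sgn_div_norm dot_square_norm power2_eq_square)
  ultimately show "norm (\<pi> u - \<pi> s) \<le> M * (u - s)" by simp
qed

lemma trajectory_segment:
  assumes traj: "(T, \<pi>) \<in> trajectories F Obs x y" and su: "0 \<le> s" "s \<le> u" "u \<le> T"
    and near: "\<And>t. t \<in> {s..u} \<Longrightarrow> \<pi> t \<in> cball y0 \<delta>"
  shows "(u - s, \<lambda>t. \<pi> (s + t)) \<in> trajectories F Obs (\<pi> s) (\<pi> u)"
proof -
  obtain N where N: "negligible N" "\<And>t. t \<in> {0..T} - N \<Longrightarrow> \<exists>v\<in>F (\<pi> t). (\<pi> has_vector_derivative v) (at t within {0..T})"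
    and free: "\<And>t. t \<in> {0..T} \<Longrightarrow> \<pi> t \<in> closure (- Obs)"
    using traj unfolding trajectories_iff by blast
  have lip: "norm (\<pi> (s + t2) - \<pi> (s + t1)) \<le> M * (t2 - t1)" if "0 \<le> t1" "t1 \<le> t2" "t2 \<le> u - s" for t1 t2
    using segment_increment(1)[OF traj, of "s + t1" "s + t2"] near su that by auto
  \<comment> \<open>Staying near \<open>y0\<close> makes the segment Lipschitz, which gives absolute
    continuity of the shifted curve without shifting divisions.\<close>
  have "M-lipschitz_on {0..u - s} (\<lambda>t. \<pi> (s + t))"
  proof (rule lipschitz_onI)
    fix t1 t2 assume "t1 \<in> {0..u - s}" "t2 \<in> {0..u - s}"
    then show "dist (\<pi> (s + t1)) (\<pi> (s + t2)) \<le> M * dist t1 t2"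
      using lip[of t1 t2] lip[of t2 t1] by (cases "t1 \<le> t2") (auto simp: dist_norm norm_minus_commute)
  qed (use pos in auto)
  moreover have "\<exists>v\<in>F (\<pi> (s + t)). ((\<lambda>t. \<pi> (s + t)) has_vector_derivative v) (at t within {0..u - s})"
    if t: "t \<in> {0..u - s} - (+) (- s) ` N" for t
  proof -
    have "s + t \<notin> N" using t by (force simp: image_iff)
    then obtain v where v: "v \<in> F (\<pi> (s + t))" "(\<pi> has_vector_derivative v) (at (s + t) within {0..T})"
      using N(2)[of "s + t"] t su by auto
    have "((+) s has_vector_derivative 1) (at t within {0..u - s})"
      by (auto intro!: derivative_eq_intros)
    moreover have "(\<pi> has_vector_derivative v) (at (s + t) within (+) s ` {0..u - s})"
      using su by (intro has_vector_derivative_within_subset[OF v(2)]) auto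
    ultimately have "(\<pi> \<circ> (+) s has_vector_derivative 1 *\<^sub>R v) (at t within {0..u - s})"
      by (rule vector_diff_chain_within)
    then show ?thesis using v by (auto simp: o_def)
  qed
  moreover have "negligible ((+) (- s) ` N)"
    using N(1) by (rule negligible_translation)
  ultimately show ?thesis
    unfolding trajectories_iff using su free by (auto intro: abs_continuous_on_interval_lipschitz)
qed

lemma AE_running_cost:
  assumes traj: "(T, \<pi>) \<in> trajectories F Obs x y" and "0 < T"
  shows "AE t in lebesgue. t \<in> {0..T} \<longrightarrow> \<pi> t \<in> cball y0 \<delta> \<longrightarrow>
    m \<le> \<psi> (\<pi> t, vector_derivative \<pi> (at t within {0..T})) \<and>
    \<psi> (\<pi> t, vector_derivative \<pi> (at t within {0..T})) \<le> P"
proof -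
  have "AE t in lebesgue. t \<in> {0..T} \<longrightarrow> (\<exists>v\<in>F (\<pi> t). (\<pi> has_vector_derivative v) (at t within {0..T}))"
    using traj by (simp add: trajectories_def)
  then show ?thesis
  proof (rule AE_mp, intro AE_I2 impI)
    fix t assume *: "t \<in> {0..T} \<longrightarrow> (\<exists>v\<in>F (\<pi> t). (\<pi> has_vector_derivative v) (at t within {0..T}))"
      and t: "t \<in> {0..T}" and near: "\<pi> t \<in> cball y0 \<delta>"
    then obtain v where v: "v \<in> F (\<pi> t)" "(\<pi> has_vector_derivative v) (at t within {0..T})" by blast
    \<comment> \<open>The cost uses a chosen derivative; it is the admissible velocity because
      derivatives within an interval of positive length are unique.\<close>
    have "vector_derivative \<pi> (at t within {0..T}) = v"
      using v t \<open>0 < T\<close> by (intro vector_derivative_within_closed_interval) auto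
    then show "m \<le> \<psi> (\<pi> t, vector_derivative \<pi> (at t within {0..T})) \<and>
        \<psi> (\<pi> t, vector_derivative \<pi> (at t within {0..T})) \<le> P"
      using running_cost[OF near speed[OF near v(1)]] by simp
  qed
qed

lemma traj_cost_le:
  assumes traj: "(T, \<pi>) \<in> trajectories F Obs x y"
    and near: "\<And>t. t \<in> {0..T} \<Longrightarrow> \<pi> t \<in> cball y0 \<delta>"
  shows "traj_cost \<psi> (T, \<pi>) \<le> ennreal (P * T)"
proof -
  have T: "0 \<le> T" using traj by (simp add: trajectories_iff)
  have "traj_cost \<psi> (T, \<pi>) \<le> (\<integral>\<^sup>+ t\<in>{0..T}. ennreal P \<partial>lebesgue)"
  proof (cases "T = 0")
    case True
    \<comment> \<open>For \<open>T = 0\<close> the derivative within a point is arbitrary, but the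
      integral runs over a null set.\<close>
    have "AE t in lebesgue. t \<notin> {0::real}"
      by (rule AE_not_in) (simp add: negligible_iff_null_sets[symmetric])
    then have "traj_cost \<psi> (T, \<pi>) \<le> (\<integral>\<^sup>+ t. 0 \<partial>(lebesgue :: real measure))"
      unfolding traj_cost_def prod.case True by (intro nn_integral_mono_AE) (auto simp: indicator_def)
    then show ?thesis by simp
  next
    case False
    then show ?thesis
      unfolding traj_cost_def prod.case using AE_running_cost[OF traj] T near
      by (intro nn_integral_mono_AE) (auto simp: indicator_def intro!: ennreal_leI)
  qed
  also have "\<dots> = ennreal (P * T)"
    using T pos by (simp add: nn_integral_cmult_indicator ennreal_mult)
  finally show ?thesis .
qed

lemma traj_cost_ge:
  assumes traj: "(T, \<pi>) \<in> trajectories F Obs x y" and su: "0 \<le> s" "s \<le> u" "u \<le> T"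
    and near: "\<And>t. t \<in> {s..u} \<Longrightarrow> \<pi> t \<in> cball y0 \<delta>"
  shows "ennreal (m * (u - s)) \<le> traj_cost \<psi> (T, \<pi>)"
proof (cases "s = u")
  case False
  have "ennreal (m * (u - s)) = (\<integral>\<^sup>+ t\<in>{s..u}. ennreal m \<partial>lebesgue)"
    using su pos by (simp add: nn_integral_cmult_indicator ennreal_mult)
  also have "\<dots> \<le> traj_cost \<psi> (T, \<pi>)"
    unfolding traj_cost_def prod.case using AE_running_cost[OF traj] su near False
    by (intro nn_integral_mono_AE) (auto simp: indicator_def intro!: ennreal_leI)
  finally show ?thesis .
qed simp

lemma d_c_segment_le:
  assumes traj: "(T, \<pi>) \<in> trajectories F Obs x y" and su: "0 \<le> s" "s \<le> u" "u \<le> T"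
    and near: "\<And>t. t \<in> {s..u} \<Longrightarrow> \<pi> t \<in> cball y0 \<delta>"
  shows "d_c F \<psi> Obs (\<pi> s) (\<pi> u) \<le> ennreal (P * (u - s))"
proof -
  note seg = trajectory_segment[OF assms]
  have "d_c F \<psi> Obs (\<pi> s) (\<pi> u) \<le> traj_cost \<psi> (u - s, \<lambda>t. \<pi> (s + t))"
    unfolding d_c_def by (rule INF_lower[OF seg])
  also have "\<dots> \<le> ennreal (P * (u - s))"
    by (rule traj_cost_le[OF seg]) (use near in auto)
  finally show ?thesis .
qed

section \<open>Confinement of trajectories and first contact with the obstacle\<close>

lemma continuous_on_dist_trajectory:
  assumes "(T, \<pi>) \<in> trajectories F Obs x y"
  shows "continuous_on {0..T} \<pi>" "continuous_on {0..T} (\<lambda>t. dist y0 (\<pi> t))"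
proof -
  show "continuous_on {0..T} \<pi>"
    using abs_continuous_on_interval_imp_continuous assms by (auto simp: trajectories_iff)
  then show "continuous_on {0..T} (\<lambda>t. dist y0 (\<pi> t))"
    by (intro continuous_intros)
qed

text \<open>The speed bound is known only inside the ball, so it is applied up to the first time at
  which the distance to \<open>y0\<close> equals \<open>R\<close>; until then the trajectory has
  moved too little to get there.\<close>

lemma trajectory_stays_near:
  assumes traj: "(T, \<pi>) \<in> trajectories F Obs x y" and u: "0 \<le> u" "u \<le> T"
    and R: "norm (x - y0) + M * u < R" "R \<le> \<delta>" and t: "t \<in> {0..u}"
  shows "\<pi> t \<in> ball y0 R"
proof (rule ccontr)
  assume "\<pi> t \<notin> ball y0 R"
  then have out: "R \<le> dist y0 (\<pi> t)" by simp
  have x: "\<pi> 0 = x" using traj by (simp add: trajectories_iff)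
  have "0 \<le> M * u" using pos u by simp
  then have start: "dist y0 (\<pi> 0) < R"
    using R(1) x by (simp add: dist_norm norm_minus_commute)
  have "continuous_on {0..u} (\<lambda>t. dist y0 (\<pi> t))"
    using continuous_on_dist_trajectory[OF traj] u by (auto elim: continuous_on_subset)
  then obtain t1 where t1: "0 < t1" "t1 \<le> u" "dist y0 (\<pi> t1) = R" "\<And>s. s \<in> {0..t1} \<Longrightarrow> dist y0 (\<pi> s) \<le> R"
    by (rule first_exit_time[OF _ start t out]) blast
  then have "norm (\<pi> t1 - \<pi> 0) \<le> M * (t1 - 0)"
    using u R(2) by (intro segment_increment[OF traj]) (auto intro: order_trans)
  also have "\<dots> \<le> M * u" using t1 pos by simp
  finally have "dist y0 (\<pi> t1) \<le> norm (x - y0) + M * u"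
    using x norm_triangle_ineq[of "\<pi> t1 - x" "x - y0"] by (simp add: dist_norm norm_minus_commute)
  then show False using t1(3) R(1) by simp
qed

text \<open>The duration is not bounded in advance. But a trajectory with an end at
  \<open>y0\<close> that gets as far as \<open>R\<close> crosses distance \<open>R\<close> inside
  the ball, just after leaving \<open>y0\<close> or just before arriving; this takes time at least
  \<open>R / M\<close> and so costs at least \<open>m * R / M\<close>.\<close>

lemma cheap_trajectory_near:
  assumes traj: "(T, \<pi>) \<in> trajectories F Obs x y" and "x = y0 \<or> y = y0"
    and R: "0 < R" "R \<le> \<delta>" and cost: "traj_cost \<psi> (T, \<pi>) < ennreal (m * R / M)"
    and t: "t \<in> {0..T}"
  shows "\<pi> t \<in> ball y0 R"
proof (rule ccontr)
  assume "\<pi> t \<notin> ball y0 R"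
  then have out: "R \<le> dist y0 (\<pi> t)" by simp
  note cont = continuous_on_dist_trajectory(2)[OF traj]
  have ends: "\<pi> 0 = x" "\<pi> T = y" "0 \<le> T" using traj by (auto simp: trajectories_iff)
  have "\<exists>s u. 0 \<le> s \<and> s \<le> u \<and> u \<le> T \<and> norm (\<pi> u - \<pi> s) = R \<and> (\<forall>t\<in>{s..u}. \<pi> t \<in> cball y0 R)"
  proof (cases "x = y0")
    case True
    then have "dist y0 (\<pi> 0) < R" using ends R by simp
    then obtain t1 where "0 < t1" "t1 \<le> T" "dist y0 (\<pi> t1) = R" "\<And>s. s \<in> {0..t1} \<Longrightarrow> dist y0 (\<pi> s) \<le> R"
      by (rule first_exit_time[OF cont _ t out]) blast
    then show ?thesis
      using True ends by (intro exI[of _ 0] exI[of _ t1]) (auto simp: dist_norm norm_minus_commute)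
  next
    case False
    then have "dist y0 (\<pi> T) < R" using ends R assms(2) by simp
    then obtain t1 where "0 \<le> t1" "t1 < T" "dist y0 (\<pi> t1) = R" "\<And>s. s \<in> {t1..T} \<Longrightarrow> dist y0 (\<pi> s) \<le> R"
      by (rule last_entry_time[OF cont _ t out]) blast
    then show ?thesis
      using False assms(2) ends by (intro exI[of _ t1] exI[of _ T]) (auto simp: dist_norm)
  qed
  then obtain s u where su: "0 \<le> s" "s \<le> u" "u \<le> T" "norm (\<pi> u - \<pi> s) = R" "\<And>t. t \<in> {s..u} \<Longrightarrow> \<pi> t \<in> cball y0 \<delta>"
    using R by fastforce
  have "R \<le> M * (u - s)"
    using segment_increment(1)[OF traj su(1-3,5)] su(4) by simp
  then have "m * R \<le> m * (M * (u - s))"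
    using pos by (intro mult_left_mono) auto
  then have "m * R / M \<le> m * (u - s)"
    using pos by (simp add: divide_le_eq mult_ac)
  then have "ennreal (m * R / M) \<le> traj_cost \<psi> (T, \<pi>)"
    using traj_cost_ge[OF traj su(1-3,5)] by (meson ennreal_leI order_trans)
  then show False using cost by simp
qed

text \<open>The trajectory is cut at its first contact with \<open>Obs\<close>. The contact point is
  on the frontier, since trajectories stay in the closure of free space. Free points just before it
  reach it at arbitrarily small cost, so it is not in \<open>unreachable_boundary\<close> and hence
  not in \<open>U\<close>. Contact later than \<open>\<tau>\<close> would already cost
  \<open>m * \<tau>\<close>.\<close>

lemma cheap_hit:
  assumes unreach: "U \<inter> frontier Obs \<subseteq> unreachable_boundary F \<psi> Obs"
    and x: "x \<notin> Obs" and clr: "clr F \<psi> Obs x < ennreal (m * \<tau>)" and "0 < \<tau>"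
    and R: "norm (x - y0) + M * \<tau> < R" "R \<le> \<delta>"
  obtains T \<pi> y where "(T, \<pi>) \<in> trajectories F Obs x y" "y \<in> Obs" "y \<notin> U" "0 < T" "T \<le> \<tau>"
    "\<And>t. t \<in> {0..T} \<Longrightarrow> \<pi> t \<in> ball y0 R"
proof -
  obtain y T \<pi> where y: "y \<in> Obs" and traj: "(T, \<pi>) \<in> trajectories F Obs x y"
    and cost: "traj_cost \<psi> (T, \<pi>) < ennreal (m * \<tau>)"
    using clr unfolding clr_def d_c_def INF_less_iff by auto
  have ends: "\<pi> 0 = x" "\<pi> T = y" "0 \<le> T" and free: "\<And>t. t \<in> {0..T} \<Longrightarrow> \<pi> t \<in> closure (- Obs)"
    using traj by (auto simp: trajectories_iff)
  have "closed ({0..T} \<inter> \<pi> -` Obs)"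
    using continuous_on_dist_trajectory(1)[OF traj] closed_Obs by (intro continuous_closed_preimage) auto
  then have "compact ({0..T} \<inter> \<pi> -` Obs)"
    by (simp add: compact_eq_bounded_closed bounded_Int)
  moreover have "T \<in> {0..T} \<inter> \<pi> -` Obs" using ends y by auto
  ultimately have "\<exists>t1 \<in> {0..T} \<inter> \<pi> -` Obs. \<forall>t \<in> {0..T} \<inter> \<pi> -` Obs. t1 \<le> t"
    by (intro compact_attains_inf) auto
  then obtain t1 where t1: "t1 \<in> {0..T}" "\<pi> t1 \<in> Obs" "\<And>t. t \<in> {0..T} \<Longrightarrow> \<pi> t \<in> Obs \<Longrightarrow> t1 \<le> t"
    by auto
  have "t1 \<noteq> 0" using t1(2) ends x by auto
  then have "0 < t1" using t1(1) by simp
  have "t1 \<le> \<tau>"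
  proof (rule ccontr)
    assume "\<not> t1 \<le> \<tau>"
    then have \<tau>: "0 \<le> \<tau>" "\<tau> \<le> T" using \<open>0 < \<tau>\<close> t1(1) by auto
    have "\<pi> t \<in> cball y0 \<delta>" if "t \<in> {0..\<tau>}" for t
      using trajectory_stays_near[OF traj \<tau> R that] R by auto
    then have "ennreal (m * (\<tau> - 0)) \<le> traj_cost \<psi> (T, \<pi>)"
      using \<tau> by (intro traj_cost_ge[OF traj]) auto
    then show False using cost by simp
  qed
  have near: "\<pi> t \<in> ball y0 R" if "t \<in> {0..t1}" for t
  proof (rule trajectory_stays_near[OF traj _ _ _ R(2) that])
    show "norm (x - y0) + M * t1 < R"
      using R(1) mult_left_mono[OF \<open>t1 \<le> \<tau>\<close> less_imp_le[OF pos(2)]] by simp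
  qed (use t1 in auto)
  then have near': "\<pi> t \<in> cball y0 \<delta>" if "t \<in> {0..t1}" for t
    using R that by fastforce
  have "\<pi> t1 \<notin> U"
  proof
    assume "\<pi> t1 \<in> U"
    moreover have "\<pi> t1 \<in> frontier Obs"
      using t1(1,2) free closed_Obs by (auto simp: frontier_closures)
    ultimately obtain \<rho> where \<rho>: "0 < \<rho>" "backward_reach F \<psi> Obs \<rho> (\<pi> t1) \<inter> - Obs = {}"
      using unreach by (auto simp: unreachable_boundary_def)
    \<comment> \<open>Late enough that the remaining cost is at most \<open>\<rho> / 2\<close>, yet
      strictly before first contact.\<close>
    define s where "s = max 0 (t1 - \<rho> / (2 * P))"
    have s: "0 \<le> s" "s < t1" "t1 - s \<le> \<rho> / (2 * P)"
      using \<rho> pos \<open>0 < t1\<close> by (auto simp: s_def)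
    have "d_c F \<psi> Obs (\<pi> s) (\<pi> t1) \<le> ennreal (P * (t1 - s))"
      using s t1 near' by (intro d_c_segment_le[OF traj]) auto
    also have "\<dots> < ennreal \<rho>"
    proof (rule ennreal_lessI)
      have "P * (t1 - s) \<le> P * (\<rho> / (2 * P))"
        using s pos by (intro mult_left_mono) auto
      then show "P * (t1 - s) < \<rho>" using \<rho> pos by simp
    qed (use \<rho> in auto)
    finally have "\<pi> s \<in> Obs"
      using \<rho>(2) by (auto simp: backward_reach_def)
    then show False using t1(1) t1(3)[of s] s by auto
  qed
  moreover have "(t1, \<pi>) \<in> trajectories F Obs x (\<pi> t1)"
    using trajectory_segment[OF traj, of 0 t1] t1(1) near' ends by simp
  ultimately show thesis
    using that[of t1 \<pi> "\<pi> t1"] t1(2) \<open>0 < t1\<close> \<open>t1 \<le> \<tau>\<close> near by blast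
qed

end

section \<open>Limits of trajectories\<close>

context local_control_bounds
begin

lemma trajectory_lipschitz:
  assumes traj: "(T, \<pi>) \<in> trajectories F Obs x y"
    and near: "\<And>t. t \<in> {0..T} \<Longrightarrow> \<pi> t \<in> cball y0 \<delta>"
  shows "M-lipschitz_on {0..T} \<pi>"
proof (rule lipschitz_onI)
  fix s t assume "s \<in> {0..T}" "t \<in> {0..T}"
  then show "dist (\<pi> s) (\<pi> t) \<le> M * dist s t"
    using segment_increment(1)[OF traj, of s t] segment_increment(1)[OF traj, of t s] near
    by (cases "s \<le> t") (auto simp: dist_norm norm_minus_commute)
qed (use pos in auto)

text \<open>
  A limit velocity outside the convex set \<open>F z\<close> is separated from it by a hyperplane; the separation
  persists for the velocities near \<open>z\<close>, hence for difference quotients of the approximating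
  trajectories, hence for those of the limit.
\<close>

lemma limit_velocity_admissible:
  assumes convex: "convex (F z)" and closed: "closed (F z)" and z: "z \<in> cball y0 \<delta>"
    and lip: "0 < k" "\<And>x. x \<in> cball y0 \<delta> \<Longrightarrow>
      F x \<subseteq> {w + (k * norm (x - z)) *\<^sub>R u | w u. w \<in> F z \<and> u \<in> cball 0 1}"
    and traj: "\<And>n. (T n, p n) \<in> trajectories F Obs (X n) (Y n)"
    and near: "\<And>n t. t \<in> {0..T n} \<Longrightarrow> p n t \<in> cball y0 \<delta>"
    and t: "0 \<le> t" "t < S" and S: "\<And>s. s < S \<Longrightarrow> \<forall>\<^sub>F n in sequentially. s < T n"
    and lim: "\<And>s. t \<le> s \<Longrightarrow> s < S \<Longrightarrow> (\<lambda>n. p n s) \<longlonglongrightarrow> \<pi> s"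
    and \<pi>t: "\<pi> t = z" and deriv: "(\<pi> has_vector_derivative v) (at t)"
  shows "v \<in> F z"
proof (rule ccontr)
  assume "v \<notin> F z"
  then obtain a b where ab: "a \<bullet> v < b" "\<And>u. u \<in> F z \<Longrightarrow> b < a \<bullet> u"
    using separating_hyperplane_closed_point[OF convex closed] by blast
  define \<epsilon> where "\<epsilon> = (b - a \<bullet> v) / 2"
  have \<epsilon>: "0 < \<epsilon>" "a \<bullet> v = b - 2 * \<epsilon>" using ab(1) by (auto simp: \<epsilon>_def field_simps)
  \<comment> \<open>Chosen so that against \<open>a\<close> the derivative error contributes less
    than \<open>\<epsilon>\<close>, and a velocity perturbation of size
    \<open>2 * \<epsilon>'\<close> at most \<open>\<epsilon>\<close>; the gap
    \<open>b - a \<bullet> v\<close> is \<open>2 * \<epsilon>\<close>.\<close>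
  define \<epsilon>' where "\<epsilon>' = \<epsilon> / (2 * (norm a + 1))"
  have na: "0 < norm a + 1" by (simp add: add_nonneg_pos)
  have \<epsilon>': "0 < \<epsilon>'" "norm a * \<epsilon>' < \<epsilon>"
  proof -
    show "0 < \<epsilon>'" using \<epsilon>(1) na by (simp add: \<epsilon>'_def)
    have "(norm a + 1) * \<epsilon>' = \<epsilon> / 2" using na by (simp add: \<epsilon>'_def field_simps)
    moreover have "norm a * \<epsilon>' \<le> (norm a + 1) * \<epsilon>'" using \<open>0 < \<epsilon>'\<close> by (intro mult_right_mono) auto
    ultimately show "norm a * \<epsilon>' < \<epsilon>" using \<epsilon>(1) by simp
  qed
  obtain d where d: "0 < d" "\<And>s. norm (s - t) < d \<Longrightarrow> norm (\<pi> s - \<pi> t - (s - t) *\<^sub>R v) \<le> \<epsilon>' * norm (s - t)"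
    using deriv \<epsilon>'(1) unfolding has_vector_derivative_def has_derivative_within_alt by auto
  \<comment> \<open>A forward time step within the range \<open>d\<close> of the derivative estimate
    and ending before \<open>S\<close>. During it \<open>p n\<close> is within
    \<open>2 * M * \<sigma>\<close> of \<open>z\<close>: half from its own motion, half from the
    distance of \<open>p n t\<close> to \<open>z\<close>. The last bound turns this into a velocity
    perturbation of at most \<open>2 * \<epsilon>'\<close>.\<close>
  define \<sigma> where "\<sigma> = min (min (d / 2) ((S - t) / 2)) (\<epsilon>' / (k * M))"
  have \<sigma>: "0 < \<sigma>" "\<sigma> < d" "t + \<sigma> < S" "k * (2 * M * \<sigma>) \<le> 2 * \<epsilon>'"
  proof -
    have "0 < \<epsilon>' / (k * M)" using \<epsilon>'(1) pos lip(1) by simp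
    then show "0 < \<sigma>" using d(1) t by (simp add: \<sigma>_def)
    have "\<sigma> \<le> d / 2" "\<sigma> \<le> (S - t) / 2"
      unfolding \<sigma>_def by (rule order_trans[OF min.cobounded1 min.cobounded1] order_trans[OF min.cobounded1 min.cobounded2])+
    then show "\<sigma> < d" "t + \<sigma> < S" using d(1) t by auto
    have "\<sigma> \<le> \<epsilon>' / (k * M)" by (simp add: \<sigma>_def)
    then have "\<sigma> * (k * M) \<le> \<epsilon>'" using pos lip(1) by (simp add: pos_le_divide_eq)
    then show "k * (2 * M * \<sigma>) \<le> 2 * \<epsilon>'" by (simp add: mult_ac)
  qed
  have "\<forall>\<^sub>F n in sequentially. dist (p n t) (\<pi> t) < M * \<sigma>"
    using lim[of t] t \<sigma> pos by (intro tendstoD) auto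
  with S[OF \<sigma>(3)] have ev: "\<forall>\<^sub>F n in sequentially. (b - \<epsilon>) * \<sigma> \<le> a \<bullet> (p n (t + \<sigma>) - p n t)"
  proof eventually_elim
    case (elim n)
    have "(- a) \<bullet> (p n (t + \<sigma>) - p n t) \<le> (- (b - \<epsilon>)) * ((t + \<sigma>) - t)"
    proof (rule trajectory_increment_le[OF traj])
      fix s u assume s: "s \<in> {t..t + \<sigma>}" and u: "u \<in> F (p n s)"
      have ps: "p n s \<in> cball y0 \<delta>" using near s elim t by auto
      then obtain w u' where w: "u = w + (k * norm (p n s - z)) *\<^sub>R u'" "w \<in> F z" "norm u' \<le> 1"
        using lip(2) u by fastforce
      have "norm (p n s - p n t) \<le> M * (s - t)"
        using s elim t near by (intro segment_increment[OF traj]) auto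
      also have "\<dots> \<le> M * \<sigma>" using s pos by (intro mult_left_mono) auto
      finally have "norm (p n s - z) \<le> 2 * M * \<sigma>"
        using norm_triangle_ineq[of "p n s - p n t" "p n t - z"] elim \<pi>t by (simp add: dist_norm)
      then have "k * norm (p n s - z) \<le> 2 * \<epsilon>'"
        using \<sigma>(4) lip(1) by (meson mult_left_mono less_imp_le order_trans)
      then have "norm ((k * norm (p n s - z)) *\<^sub>R u') \<le> 2 * \<epsilon>' * 1"
        using lip(1) \<epsilon>' w(3) unfolding norm_scaleR by (intro mult_mono) auto
      then have "\<bar>a \<bullet> ((k * norm (p n s - z)) *\<^sub>R u')\<bar> \<le> norm a * (2 * \<epsilon>')"
        by (intro order_trans[OF Cauchy_Schwarz_ineq2] mult_left_mono) auto
      also have "norm a * (2 * \<epsilon>') \<le> \<epsilon>"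
      proof -
        have "norm a * (2 * \<epsilon>') \<le> (norm a + 1) * (2 * \<epsilon>')"
          using \<epsilon>' by (intro mult_right_mono) auto
        also have "\<dots> = \<epsilon>" using na by (simp add: \<epsilon>'_def field_simps)
        finally show ?thesis .
      qed
      finally show "(- a) \<bullet> u \<le> - (b - \<epsilon>)"
        using ab(2)[OF w(2)] w(1) by (simp add: inner_add_right)
    qed (use t \<sigma> elim in auto)
    then show ?case
      unfolding inner_minus_left mult_minus_left add_diff_cancel_left' neg_le_iff_le .
  qed
  have "(\<lambda>n. a \<bullet> (p n (t + \<sigma>) - p n t)) \<longlonglongrightarrow> a \<bullet> (\<pi> (t + \<sigma>) - \<pi> t)"
    using t \<sigma> by (intro tendsto_intros lim) auto
  then have lower: "(b - \<epsilon>) * \<sigma> \<le> a \<bullet> (\<pi> (t + \<sigma>) - \<pi> t)"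
    by (rule tendsto_lowerbound[OF _ ev]) simp
  have "norm (\<pi> (t + \<sigma>) - \<pi> t - \<sigma> *\<^sub>R v) \<le> \<epsilon>' * \<sigma>"
    using d(2)[of "t + \<sigma>"] \<sigma> by simp
  then have "a \<bullet> (\<pi> (t + \<sigma>) - \<pi> t - \<sigma> *\<^sub>R v) \<le> norm a * (\<epsilon>' * \<sigma>)"
    by (intro order_trans[OF norm_cauchy_schwarz] mult_left_mono) auto
  then have "a \<bullet> (\<pi> (t + \<sigma>) - \<pi> t) \<le> (a \<bullet> v + norm a * \<epsilon>') * \<sigma>"
    by (simp add: inner_diff_right algebra_simps)
  also have "\<dots> < (b - \<epsilon>) * \<sigma>"
    using \<epsilon> \<epsilon>' \<sigma> by (intro mult_strict_right_mono) auto
  finally show False using lower by simp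
qed

text \<open>The durations vary, so each trajectory is frozen after its end by \<open>cl\<close>,
  which puts all of them on \<open>{0..\<tau>}\<close> with a common Lipschitz constant.
  Arzela-Ascoli gives a uniform limit, and a further subsequence makes the durations
  converge.\<close>

lemma trajectory_limit:
  assumes convex: "\<And>x. convex (F x)" and closed: "\<And>x. closed (F x)"
    and lip: "0 < k" "\<And>x y. x \<in> cball y0 \<delta> \<Longrightarrow> y \<in> cball y0 \<delta> \<Longrightarrow>
      F x \<subseteq> {w + (k * norm (x - y)) *\<^sub>R u | w u. w \<in> F y \<and> u \<in> cball 0 1}"
    and X: "X \<longlonglongrightarrow> x"
    and traj: "\<And>n. (T n, p n) \<in> trajectories F Obs (X n) (Y n)"
    and Y: "\<And>n. Y n \<in> Obs" and T: "\<And>n. T n \<le> \<tau>"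
    and near: "\<And>n t. t \<in> {0..T n} \<Longrightarrow> p n t \<in> cball y0 \<delta>"
  obtains S \<pi> y where "(S, \<pi>) \<in> trajectories F Obs x y" "y \<in> Obs" "S \<le> \<tau>"
    "\<And>t. t \<in> {0..S} \<Longrightarrow> \<pi> t \<in> cball y0 \<delta>"
proof -
  have ends: "0 \<le> T n" "p n 0 = X n" "p n (T n) = Y n" and free: "\<And>t. t \<in> {0..T n} \<Longrightarrow> p n t \<in> closure (- Obs)" for n
    using traj[of n] by (auto simp: trajectories_iff)
  define cl :: "real \<Rightarrow> real \<Rightarrow> real" where "cl c t = max 0 (min t c)" for c t
  have cl: "0 \<le> c \<Longrightarrow> cl c t \<in> {0..c}" "t \<in> {0..c} \<Longrightarrow> cl c t = t" "\<bar>cl c s - cl c t\<bar> \<le> \<bar>s - t\<bar>" for c s t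
    by (auto simp: cl_def)
  define q where "q n t = p n (cl (T n) t)" for n t
  have q_lip: "norm (q n s - q n t) \<le> M * \<bar>s - t\<bar>" for n s t
  proof -
    have "norm (q n s - q n t) \<le> M * \<bar>cl (T n) s - cl (T n) t\<bar>"
      using lipschitz_onD[OF trajectory_lipschitz[OF traj near], of n "cl (T n) s" "cl (T n) t"] cl(1) ends(1)
      by (simp add: q_def dist_norm)
    also have "\<dots> \<le> M * \<bar>s - t\<bar>" using cl(3) pos by (intro mult_left_mono) auto
    finally show ?thesis .
  qed
  have q_in: "q n t \<in> cball y0 \<delta> \<inter> closure (- Obs)" for n t
    using near free cl(1)[OF ends(1)] by (auto simp: q_def simp del: mem_cball)
  obtain g r where g: "continuous_on {0..\<tau>} g" and r: "strict_mono (r :: nat \<Rightarrow> nat)"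
    and unif: "\<And>e. 0 < e \<Longrightarrow> \<exists>N. \<forall>n x. n \<ge> N \<and> x \<in> {0..\<tau>} \<longrightarrow> norm (q (r n) x - g x) < e"
  proof (rule Arzela_Ascoli[of "{0..\<tau>}" q "norm y0 + \<delta>"])
    show "norm (q n t) \<le> norm y0 + \<delta>" for n t
      using q_in[of n t] norm_triangle_sub[of "q n t" y0] by (auto simp: dist_norm norm_minus_commute)
    fix t e :: real assume "0 < e"
    show "\<exists>d>0. \<forall>n s. s \<in> {0..\<tau>} \<and> norm (t - s) < d \<longrightarrow> norm (q n t - q n s) < e"
    proof (intro exI[of _ "e / M"] conjI allI impI)
      fix n s assume "s \<in> {0..\<tau>} \<and> norm (t - s) < e / M"
      then have "M * \<bar>t - s\<bar> < e" using pos by (simp add: field_simps)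
      then show "norm (q n t - q n s) < e" using q_lip[of n t s] by simp
    qed (use \<open>0 < e\<close> pos in auto)
  qed auto
  have "\<forall>n. T (r n) \<in> {0..\<tau>}" using ends T by auto
  then obtain S r' where S: "S \<in> {0..\<tau>}" and r': "strict_mono (r' :: nat \<Rightarrow> nat)"
    and TS: "((\<lambda>n. T (r n)) \<circ> r') \<longlonglongrightarrow> S"
    using compact_Icc[of 0 \<tau>] unfolding compact_def by metis
  define j where "j = r \<circ> r'"
  have j: "strict_mono j" using r r' by (simp add: j_def strict_mono_o)
  have Tj: "(\<lambda>n. T (j n)) \<longlonglongrightarrow> S" using TS by (simp add: j_def o_def)
  have lim: "(\<lambda>n. q (j n) t) \<longlonglongrightarrow> g t" if "t \<in> {0..\<tau>}" for t
  proof -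
    have "(\<lambda>n. q (r n) t) \<longlonglongrightarrow> g t"
      unfolding LIMSEQ_def dist_norm using unif that by blast
    then show ?thesis
      using LIMSEQ_subseq_LIMSEQ[OF _ r'] by (simp add: j_def o_def)
  qed
  \<comment> \<open>Clamping at the limit duration makes \<open>\<pi>\<close> Lipschitz on the whole
    line, the form in which almost everywhere differentiability was proved.\<close>
  define \<pi> where "\<pi> t = g (cl S t)" for t
  have clS: "cl S t \<in> {0..\<tau>}" for t
    using cl(1)[of S t] S by auto
  have lim\<pi>: "(\<lambda>n. q (j n) (cl S t)) \<longlonglongrightarrow> \<pi> t" for t
    unfolding \<pi>_def by (rule lim[OF clS])
  have \<pi>_lip: "M-lipschitz_on UNIV \<pi>"
  proof (rule lipschitz_onI)
    fix s t
    have "(\<lambda>n. norm (q (j n) (cl S s) - q (j n) (cl S t))) \<longlonglongrightarrow> norm (\<pi> s - \<pi> t)"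
      by (intro tendsto_intros lim\<pi>)
    then have "norm (\<pi> s - \<pi> t) \<le> M * \<bar>cl S s - cl S t\<bar>"
      by (rule LIMSEQ_le_const2) (use q_lip in auto)
    also have "\<dots> \<le> M * \<bar>s - t\<bar>" using cl(3) pos by (intro mult_left_mono) auto
    finally show "dist (\<pi> s) (\<pi> t) \<le> M * dist s t" by (simp add: dist_norm)
  qed (use pos in auto)
  have \<pi>_in: "\<pi> t \<in> cball y0 \<delta> \<inter> closure (- Obs)" for t
    by (rule closed_sequentially[OF _ _ lim\<pi>]) (use q_in in auto)
  have "\<pi> 0 = x"
  proof (rule LIMSEQ_unique)
    have "q (j n) (cl S 0) = X (j n)" for n
      using ends S by (simp add: q_def cl_def)
    then show "(\<lambda>n. X (j n)) \<longlonglongrightarrow> \<pi> 0" using lim\<pi>[of 0] by simp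
    show "(\<lambda>n. X (j n)) \<longlonglongrightarrow> x" using LIMSEQ_subseq_LIMSEQ[OF X j] by (simp add: o_def)
  qed
  have "\<pi> S \<in> Obs"
  proof (rule closed_sequentially[OF closed_Obs])
    show "Y (j n) \<in> Obs" for n by (rule Y)
    have Y_q: "Y (j n) = q (j n) (T (j n))" for n
      using ends cl(2)[of "T (j n)" "T (j n)"] by (simp add: q_def)
    \<comment> \<open>The end times move with \<open>n\<close>; the common Lipschitz constant allows
      evaluation at \<open>S\<close> instead.\<close>
    have "(\<lambda>n. q (j n) (T (j n)) - q (j n) (cl S S)) \<longlonglongrightarrow> 0"
    proof (rule Lim_null_comparison)
      show "\<forall>\<^sub>F n in sequentially. norm (q (j n) (T (j n)) - q (j n) (cl S S)) \<le> M * \<bar>T (j n) - S\<bar>"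
        using q_lip S by (simp add: cl_def)
      show "(\<lambda>n. M * \<bar>T (j n) - S\<bar>) \<longlonglongrightarrow> 0"
        using Tj by (intro tendsto_mult_right_zero tendsto_rabs_zero) (simp add: LIM_zero)
    qed
    from tendsto_add[OF this lim\<pi>[of S]] show "(\<lambda>n. Y (j n)) \<longlonglongrightarrow> \<pi> S"
      by (simp add: Y_q)
  qed
  \<comment> \<open>Removing \<open>S\<close> leaves room for a forward difference quotient; at each
    time before \<open>S\<close> the approximating trajectories are eventually not yet
    frozen.\<close>
  define N where "N = {t. \<not> \<pi> differentiable (at t)} \<union> {0, S}"
  have "negligible N"
    unfolding N_def by (intro negligible_Un Lipschitz_differentiable_ae[OF \<pi>_lip] negligible_finite) auto
  moreover have "\<exists>v\<in>F (\<pi> t). (\<pi> has_vector_derivative v) (at t within {0..S})" if t: "t \<in> {0..S} - N" for t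
  proof -
    have t': "0 \<le> t" "t < S" using t by (auto simp: N_def)
    obtain v where v: "(\<pi> has_vector_derivative v) (at t)"
      using t by (auto simp: N_def vector_derivative_works)
    have "v \<in> F (\<pi> t)"
    proof (rule limit_velocity_admissible[where T = "T \<circ> j" and p = "p \<circ> j" and X = "X \<circ> j" and Y = "Y \<circ> j"
          and k = k and S = S and t = t and \<pi> = \<pi>])
      show "((T \<circ> j) n, (p \<circ> j) n) \<in> trajectories F Obs ((X \<circ> j) n) ((Y \<circ> j) n)" for n
        using traj by simp
      show evT: "\<forall>\<^sub>F n in sequentially. s < (T \<circ> j) n" if "s < S" for s
        using order_tendstoD(1)[OF Tj that] by simp
      fix s assume s: "t \<le> s" "s < S"
      have "\<forall>\<^sub>F n in sequentially. q (j n) (cl S s) = (p \<circ> j) n s"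
        using evT[OF s(2)] by eventually_elim (use s t' in \<open>auto simp: q_def cl_def\<close>)
      then show "(\<lambda>n. (p \<circ> j) n s) \<longlonglongrightarrow> \<pi> s"
        by (rule Lim_transform_eventually[OF lim\<pi>])
    qed (use convex closed lip \<pi>_in near t' v in \<open>auto simp del: mem_cball\<close>)
    then show ?thesis
      using v by (auto intro: has_vector_derivative_at_within)
  qed
  ultimately have "(S, \<pi>) \<in> trajectories F Obs x (\<pi> S)"
    unfolding trajectories_iff using S \<pi>_in \<open>\<pi> 0 = x\<close>
    by (auto intro!: abs_continuous_on_interval_lipschitz lipschitz_on_subset[OF \<pi>_lip])
  then show thesis
    using that \<open>\<pi> S \<in> Obs\<close> S \<pi>_in by (auto simp del: mem_cball)
qed

end

section \<open>The clearance gap\<close>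

text \<open>Expanding \<open>norm (r *\<^sub>R e - z) ^ 2\<close> reduces membership to the
  quadratic condition on \<open>z\<close>. A cone condition
  \<open>a * norm z \<le> e \<bullet> z\<close> implies it as soon as
  \<open>0 < norm z < 2 * r * a\<close>.\<close>

lemma mem_tangent_ball:
  fixes e z :: "'a::euclidean_space"
  assumes "norm e = 1" "norm z ^ 2 < 2 * r * (e \<bullet> z)" "0 < r"
  shows "y0 + z \<in> ball (y0 + r *\<^sub>R e) r"
proof -
  have "norm (r *\<^sub>R e - z) ^ 2 = r ^ 2 - 2 * r * (e \<bullet> z) + norm z ^ 2"
    using assms(1) by (simp add: power2_norm_eq_inner inner_diff algebra_simps inner_commute)
      (simp add: dot_square_norm power2_eq_square)
  then have "norm (r *\<^sub>R e - z) ^ 2 < r ^ 2"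
    using assms by simp
  then have "norm (r *\<^sub>R e - z) < r"
    using \<open>0 < r\<close> by (simp add: power2_less_imp_less)
  then show ?thesis
    by (simp add: dist_norm)
qed

context local_control_bounds
begin

text \<open>Starting within \<open>R / 2\<close> and running for time at most
  \<open>R / (2 * M)\<close>, the trajectory stays within \<open>R\<close> of \<open>y0\<close>. Its
  end \<open>y\<close> avoids the tangent ball, hence \<open>y - y0\<close> violates the cone
  condition; ascent accumulates faster than the cone condition demands, so \<open>T\<close> is
  limited by the initial offset.\<close>

lemma cheap_hit_quick:
  fixes r :: real
  defines "a \<equiv> \<eta> / (2 * M)"
  defines "R \<equiv> min \<delta> (2 * r * a)"
  assumes r: "0 < r" and unreach: "ball (y0 + r *\<^sub>R e) r \<inter> frontier Obs \<subseteq> unreachable_boundary F \<psi> Obs"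
    and x: "x \<notin> Obs" "norm (x - y0) < R / 2" and clr: "clr F \<psi> Obs x < ennreal (m * (R / (2 * M)))"
  obtains T \<pi> y where "(T, \<pi>) \<in> trajectories F Obs x y" "y \<in> Obs"
    "T \<le> 2 * (a + 1) / \<eta> * norm (x - y0)" "\<And>t. t \<in> {0..T} \<Longrightarrow> \<pi> t \<in> cball y0 \<delta>"
    "e \<bullet> (x - y0) < a * norm (x - y0)"
proof -
  have a: "0 < a" using pos by (simp add: a_def)
  have R: "0 < R" "R \<le> \<delta>" "R \<le> 2 * r * a" using a r pos by (auto simp: R_def)
  have "norm (x - y0) + M * (R / (2 * M)) < R" using x(2) pos by simp
  then obtain T \<pi> y where T: "(T, \<pi>) \<in> trajectories F Obs x y" "y \<in> Obs" "y \<notin> ball (y0 + r *\<^sub>R e) r"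
    "0 < T" "T \<le> R / (2 * M)" and near: "\<And>t. t \<in> {0..T} \<Longrightarrow> \<pi> t \<in> ball y0 R"
    using cheap_hit[OF unreach x(1) clr _ _ R(2)] R(1) pos by auto
  have near': "\<pi> t \<in> cball y0 \<delta>" if "t \<in> {0..T}" for t
    using near[OF that] R by auto
  have ends: "\<pi> 0 = x" "\<pi> T = y" using T(1) by (auto simp: trajectories_iff)
  have inc: "norm (y - x) \<le> M * T" "\<eta> * T \<le> e \<bullet> (y - x)"
    using segment_increment[OF T(1), of 0 T] T(4) near' ends by auto
  have eq: "e \<bullet> (y - y0) = e \<bullet> (x - y0) + e \<bullet> (y - x)" by (simp add: inner_diff_right)
  have ny: "norm (y - y0) \<le> norm (x - y0) + M * T"
    using norm_triangle_ineq[of "x - y0" "y - x"] inc by simp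
  have MT: "0 < M * T" using pos T by simp
  have aM: "a * (M * T) = \<eta> * T / 2" using pos by (simp add: a_def)
  \<comment> \<open>If this failed, \<open>y - y0\<close> would satisfy the cone condition of slope
    \<open>a\<close>, with norm below \<open>2 * r * a\<close>. Since \<open>a * (M * T)\<close> is
    half of \<open>\<eta> * T\<close>, the inequality leaves \<open>\<eta> * T / 2\<close> to bound
    the duration.\<close>
  have key: "e \<bullet> (x - y0) + \<eta> * T < a * (norm (x - y0) + M * T)"
  proof (rule ccontr)
    assume "\<not> ?thesis"
    then have up: "a * (norm (x - y0) + M * T) \<le> e \<bullet> (y - y0)"
      using inc eq by linarith
    have up_pos: "0 < a * (norm (x - y0) + M * T)"
      using a MT by (simp add: add_nonneg_pos)
    have y_lt: "norm (y - y0) < 2 * r * a"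
      using near[of T] T(4) ends R by (simp add: dist_norm norm_minus_commute)
    have "y \<noteq> y0" using up up_pos by auto
    then have "norm (y - y0) * norm (y - y0) < 2 * r * a * norm (y - y0)"
      using y_lt by (intro mult_strict_right_mono) auto
    also have "\<dots> = 2 * r * (a * norm (y - y0))" by simp
    also have "\<dots> \<le> 2 * r * (e \<bullet> (y - y0))"
      using order_trans[OF mult_left_mono[OF ny less_imp_le[OF a]] up] r by (intro mult_left_mono) auto
    finally have "y0 + (y - y0) \<in> ball (y0 + r *\<^sub>R e) r"
      by (intro mem_tangent_ball norm_e r) (simp add: power2_eq_square)
    then show False using T(3) by simp
  qed
  show thesis
  proof (rule that[OF T(1,2) _ near'])
    have "- norm (x - y0) \<le> e \<bullet> (x - y0)"
      using Cauchy_Schwarz_ineq2[of e "x - y0"] norm_e by simp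
    moreover have "2 * (a + 1) * norm (x - y0) = 2 * (a * norm (x - y0)) + 2 * norm (x - y0)"
      by (simp add: algebra_simps)
    ultimately have "\<eta> * T \<le> 2 * (a + 1) * norm (x - y0)"
      using key unfolding distrib_left[of a] aM by linarith
    then show "T \<le> 2 * (a + 1) / \<eta> * norm (x - y0)"
      using pos by (simp add: field_simps)
    have "0 < \<eta> * T" using pos T by simp
    then show "e \<bullet> (x - y0) < a * norm (x - y0)"
      using key unfolding distrib_left[of a] aM by linarith
  qed
qed

end

lemma connected_closedin_not_interior:
  assumes "connected B" "open B" "A \<subseteq> B" "closedin (top_of_set B) A" "A \<noteq> {}" "A \<noteq> B"
  obtains x where "x \<in> A" "x \<notin> interior A"
proof -
  have "\<not> open A"
    using assms unfolding connected_clopen by (auto simp: openin_open_eq)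
  then show thesis
    using that interior_subset[of A] interior_eq[of A] by blast
qed

lemma frontier_imp_rho_bounds:
  assumes "clr F \<psi> Obs x < \<infinity>" "0 < \<rho>" "x \<in> frontier (wave F \<psi> Obs \<rho>)"
  shows "rho_min F \<psi> Obs x \<le> ennreal \<rho>" "ennreal \<rho> \<le> rho_max F \<psi> Obs x"
  using assms by (auto simp: rho_min_def rho_max_def intro!: INF_lower SUP_upper)

context local_control_bounds
begin

text \<open>By the gap, clearance below \<open>\<rho>1\<close> in \<open>B\<close> already means at
  most \<open>C * s\<close>, so \<open>A\<close> is the trace on \<open>B\<close> of every wave with
  parameter in between. A point of \<open>A\<close> not interior to \<open>A\<close> is then on the
  frontier of all these waves at once.\<close>

lemma envelope_point_near:
  fixes r k :: real
  defines "a \<equiv> \<eta> / (2 * M)"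
  defines "R \<equiv> min \<delta> (2 * r * a)"
  defines "\<rho>1 \<equiv> m * (R / (2 * M))"
  defines "C \<equiv> P * (2 * (a + 1) / \<eta>)"
  assumes convex: "\<And>x. convex (F x)" and closed: "\<And>x. closed (F x)"
    and lip: "0 < k" "\<And>x y. x \<in> cball y0 \<delta> \<Longrightarrow> y \<in> cball y0 \<delta> \<Longrightarrow>
      F x \<subseteq> {w + (k * norm (x - y)) *\<^sub>R u | w u. w \<in> F y \<and> u \<in> cball 0 1}"
    and r: "0 < r" and unreach: "ball (y0 + r *\<^sub>R e) r \<inter> frontier Obs \<subseteq> unreachable_boundary F \<psi> Obs"
    and y0: "y0 \<in> Obs"
    and fwd: "\<And>\<rho>. \<rho> > 0 \<Longrightarrow> forward_reach F \<psi> Obs \<rho> y0 \<inter> - Obs \<noteq> {}"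
    and bwd: "\<And>\<rho>. \<rho> > 0 \<Longrightarrow> backward_reach F \<psi> Obs \<rho> y0 \<inter> - Obs \<noteq> {}"
    and s: "0 < s" "s \<le> R / 2" "2 * (C * s) < \<rho>1"
    and conn: "connected (ball y0 s \<inter> - Obs)"
  shows "\<exists>x\<in>wave_envelope F \<psi> Obs. x \<in> ball y0 s \<and> rho_min F \<psi> Obs x \<le> ennreal (2 * (C * s))"
proof -
  have a: "0 < a" using pos by (simp add: a_def)
  have R: "0 < R" "R \<le> \<delta>" using a r pos by (auto simp: R_def)
  have \<rho>1: "0 < \<rho>1" using R pos by (simp add: \<rho>1_def)
  have C: "0 < C" using a pos by (simp add: C_def)
  define K where "K = 2 * (a + 1) / \<eta>"
  have K: "0 < K" "C = P * K" using a pos by (auto simp: K_def C_def)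
  define B where "B = ball y0 s \<inter> - Obs"
  define A where "A = {x \<in> B. clr F \<psi> Obs x < ennreal \<rho>1}"
  have B: "open B" "connected B" using closed_Obs conn by (auto simp: B_def intro: open_Int)
  have hit: "\<exists>T \<pi> y. (T, \<pi>) \<in> trajectories F Obs x y \<and> y \<in> Obs \<and> T \<le> K * s \<and> (\<forall>t\<in>{0..T}. \<pi> t \<in> cball y0 \<delta>)"
    and not_cone: "e \<bullet> (x - y0) < a * norm (x - y0)" if x: "x \<in> A" for x
  proof -
    have "norm (x - y0) < R / 2" "x \<notin> Obs" "norm (x - y0) \<le> s"
      using x s by (auto simp: A_def B_def dist_norm norm_minus_commute)
    then obtain T \<pi> y where T: "(T, \<pi>) \<in> trajectories F Obs x y" "y \<in> Obs"
      "T \<le> K * norm (x - y0)" "\<And>t. t \<in> {0..T} \<Longrightarrow> \<pi> t \<in> cball y0 \<delta>"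
      "e \<bullet> (x - y0) < a * norm (x - y0)"
      using cheap_hit_quick[OF r unreach, of x thesis] x
      unfolding a_def[symmetric] R_def[symmetric] \<rho>1_def[symmetric] K_def[symmetric] by (auto simp: A_def)
    moreover have "K * norm (x - y0) \<le> K * s"
      using K \<open>norm (x - y0) \<le> s\<close> by (intro mult_left_mono) auto
    ultimately show "\<exists>T \<pi> y. (T, \<pi>) \<in> trajectories F Obs x y \<and> y \<in> Obs \<and> T \<le> K * s \<and> (\<forall>t\<in>{0..T}. \<pi> t \<in> cball y0 \<delta>)"
      "e \<bullet> (x - y0) < a * norm (x - y0)"
      by (meson order_trans, simp)
  qed
  have clr_le: "clr F \<psi> Obs x \<le> ennreal (C * s)"
    if T: "(T, \<pi>) \<in> trajectories F Obs x y" "y \<in> Obs" "T \<le> K * s" "\<forall>t\<in>{0..T}. \<pi> t \<in> cball y0 \<delta>" for x T \<pi> y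
  proof -
    have "clr F \<psi> Obs x \<le> d_c F \<psi> Obs x y" unfolding clr_def using T(2) by (rule INF_lower)
    also have "\<dots> \<le> traj_cost \<psi> (T, \<pi>)" unfolding d_c_def using T(1) by (rule INF_lower)
    also have "\<dots> \<le> ennreal (P * T)" using T(4) by (intro traj_cost_le[OF T(1)]) auto
    also have "\<dots> \<le> ennreal (C * s)"
      using mult_left_mono[OF T(3) less_imp_le[OF pos(5)]] by (intro ennreal_leI) (simp add: K(2) mult_ac)
    finally show ?thesis .
  qed
  have clr_A: "clr F \<psi> Obs x \<le> ennreal (C * s)" if "x \<in> A" for x
    using hit[OF that] clr_le by blast
  have "C * s < \<rho>1" using s mult_pos_pos[OF C s(1)] by linarith
  then have A_lim: "x \<in> A" if "x \<in> B" "clr F \<psi> Obs x \<le> ennreal (C * s)" for x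
    using that \<rho>1 by (auto simp: A_def intro: le_less_trans ennreal_lessI)
  have "A \<noteq> {}"
  proof -
    \<comment> \<open>The first bound makes the clearance small because \<open>y0 \<in> Obs\<close>;
      the second keeps the starting point within \<open>s\<close> of \<open>y0\<close>.\<close>
    have "0 < min \<rho>1 (m * s / M)" using \<rho>1 pos s by simp
    from bwd[OF this] obtain z where z: "z \<notin> Obs" "d_c F \<psi> Obs z y0 < ennreal (min \<rho>1 (m * s / M))"
      by (auto simp: backward_reach_def)
    then obtain T \<pi> where T: "(T, \<pi>) \<in> trajectories F Obs z y0" "traj_cost \<psi> (T, \<pi>) < ennreal (min \<rho>1 (m * s / M))"
      unfolding d_c_def INF_less_iff by auto
    have "traj_cost \<psi> (T, \<pi>) < ennreal (m * s / M)"
      using T(2) by (rule less_le_trans) (auto intro: ennreal_leI)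
    then have "\<pi> 0 \<in> ball y0 s"
      using s R T(1) by (intro cheap_trajectory_near[OF T(1)]) (auto simp: trajectories_iff)
    then have "z \<in> B" using T(1) z by (auto simp: trajectories_iff B_def)
    moreover have "clr F \<psi> Obs z \<le> d_c F \<psi> Obs z y0" unfolding clr_def using y0 by (rule INF_lower)
    ultimately have "z \<in> A"
      using z(2) by (auto simp: A_def intro: le_less_trans less_le_trans[OF _ ennreal_leI])
    then show ?thesis by blast
  qed
  moreover have "A \<noteq> B"
  proof -
    have "0 < m * s / M" using pos s by simp
    from fwd[OF this] obtain z where z: "z \<notin> Obs" "d_c F \<psi> Obs y0 z < ennreal (m * s / M)"
      by (auto simp: forward_reach_def)
    then obtain T \<pi> where T: "(T, \<pi>) \<in> trajectories F Obs y0 z" "traj_cost \<psi> (T, \<pi>) < ennreal (m * s / M)"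
      unfolding d_c_def INF_less_iff by auto
    have ends: "0 \<le> T" "\<pi> 0 = y0" "\<pi> T = z" using T(1) by (auto simp: trajectories_iff)
    have near: "\<pi> t \<in> ball y0 s" if "t \<in> {0..T}" for t
      using s R that T(2) by (intro cheap_trajectory_near[OF T(1)]) auto
    then have "z \<in> B" using ends z by (force simp: B_def)
    have near': "\<pi> t \<in> cball y0 \<delta>" if "t \<in> {0..T}" for t
      using near[OF that] s R by auto
    have inc: "norm (z - y0) \<le> M * T" "\<eta> * T \<le> e \<bullet> (z - y0)"
      using segment_increment[OF T(1), of 0 T] near' ends by auto
    \<comment> \<open>A trajectory leaving \<open>y0\<close> ends in the cone of slope
      \<open>a\<close>, which points of \<open>A\<close> avoid.\<close>
    have "a * norm (z - y0) \<le> a * (M * T)" using a inc by (intro mult_left_mono) auto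
    also have "\<dots> \<le> \<eta> * T" using pos ends by (simp add: a_def)
    finally have "z \<notin> A" using not_cone[of z] inc by auto
    then show ?thesis using \<open>z \<in> B\<close> by blast
  qed
  moreover have "A \<subseteq> B" by (auto simp: A_def)
  moreover have "closedin (top_of_set B) A"
  proof -
    \<comment> \<open>Points of \<open>A\<close> have hitting trajectories of duration at most
      \<open>K * s\<close>; a limit of these bounds the clearance of \<open>x\<close> by
      \<open>C * s\<close>, strictly below \<open>\<rho>1\<close>.\<close>
    have "x \<in> A" if x: "x \<in> B" "x \<in> closure A" for x
    proof -
      obtain X where X: "\<And>n. X n \<in> A" "X \<longlonglongrightarrow> x"
        using x(2) unfolding closure_sequential by blast
      from hit[OF X(1)] obtain T p Y where T: "\<And>n. (T n, p n) \<in> trajectories F Obs (X n) (Y n)"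
        "\<And>n. Y n \<in> Obs" "\<And>n. T n \<le> K * s" "\<And>n t. t \<in> {0..T n} \<Longrightarrow> p n t \<in> cball y0 \<delta>"
        by metis
      obtain S \<pi> y where "(S, \<pi>) \<in> trajectories F Obs x y" "y \<in> Obs" "S \<le> K * s"
        "\<And>t. t \<in> {0..S} \<Longrightarrow> \<pi> t \<in> cball y0 \<delta>"
        by (rule trajectory_limit[OF convex closed lip X(2) T]) blast+
      then show ?thesis using x(1) clr_le by (intro A_lim) auto
    qed
    then have "A = B \<inter> closure A" using closure_subset[of A] \<open>A \<subseteq> B\<close> by blast
    then show ?thesis using closedin_closed by blast
  qed
  ultimately obtain x where x: "x \<in> A" "x \<notin> interior A"
    using connected_closedin_not_interior B by metis
  have xf: "x \<in> frontier (wave F \<psi> Obs \<rho>)" if \<rho>: "C * s < \<rho>" "\<rho> \<le> \<rho>1" for \<rho>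
  proof -
    have "0 < \<rho>" using mult_pos_pos[OF C s(1)] \<rho> by simp
    then have "clr F \<psi> Obs x < ennreal \<rho>"
      using clr_A[OF x(1)] \<rho> by (auto intro: le_less_trans ennreal_lessI)
    then have "x \<in> wave F \<psi> Obs \<rho>"
      using x(1) by (auto simp: wave_def A_def B_def)
    moreover have "x \<notin> interior (wave F \<psi> Obs \<rho>)"
    proof
      assume int: "x \<in> interior (wave F \<psi> Obs \<rho>)"
      \<comment> \<open>Inside \<open>ball y0 s\<close> this wave is part of \<open>A\<close>, so
        its interior points there are interior to \<open>A\<close>.\<close>
      have "ennreal \<rho> \<le> ennreal \<rho>1" using \<rho> by (intro ennreal_leI)
      then have "wave F \<psi> Obs \<rho> \<inter> ball y0 s \<subseteq> A"
        by (auto simp: wave_def A_def B_def)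
      then have "interior (wave F \<psi> Obs \<rho>) \<inter> ball y0 s \<subseteq> A"
        using interior_subset by blast
      then have "interior (wave F \<psi> Obs \<rho>) \<inter> ball y0 s \<subseteq> interior A"
        by (intro interior_maximal) auto
      then show False using int x by (auto simp: A_def B_def)
    qed
    ultimately show ?thesis
      using closure_subset by (auto simp: frontier_def)
  qed
  have pos_Cs: "0 < C * s" using C s by simp
  have fin: "clr F \<psi> Obs x < \<infinity>" using clr_A[OF x(1)] by (auto intro: le_less_trans)
  \<comment> \<open>The factor 2 supplies a parameter strictly above \<open>C * s\<close>, as
    \<open>xf\<close> requires.\<close>
  have lo: "rho_min F \<psi> Obs x \<le> ennreal (2 * (C * s))"
    using pos_Cs s by (intro frontier_imp_rho_bounds[OF fin] xf) auto
  also have "\<dots> < ennreal \<rho>1" using s \<rho>1 by (intro ennreal_lessI) auto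
  also have "\<dots> \<le> rho_max F \<psi> Obs x"
    using \<rho>1 \<open>C * s < \<rho>1\<close> by (intro frontier_imp_rho_bounds[OF fin] xf) auto
  finally have "x \<in> wave_envelope F \<psi> Obs"
    using x(1) by (auto simp: wave_envelope_def A_def B_def)
  then show ?thesis using lo x(1) by (auto simp: A_def B_def)
qed

end

section \<open>Existence of the local constants and passage to small scales\<close>

lemma local_control_bounds_exist:
  fixes F :: "'a::euclidean_space \<Rightarrow> 'a set"
  assumes SH1: "SH1 F" and SH3: "SH3 F"
    and \<psi>: "continuous_on UNIV \<psi>" "\<And>z. 0 < \<psi> z" and Obs: "closed Obs"
    and e: "norm e = 1" and ham: "0 < min_hamiltonian F y0 e"
  obtains \<delta> M \<eta> m P where "local_control_bounds F \<psi> Obs y0 e \<delta> M \<eta> m P"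
proof -
  obtain M where M: "0 < M" "\<And>x v. x \<in> cball y0 1 \<Longrightarrow> v \<in> F x \<Longrightarrow> norm v \<le> M"
    using SH1 compact_cball[of y0 1] unfolding SH1_def by meson
  obtain k where k: "0 < k" "\<And>x y. x \<in> cball y0 1 \<Longrightarrow> y \<in> cball y0 1 \<Longrightarrow>
      F x \<subseteq> {w + (k * norm (x - y)) *\<^sub>R u | w u. w \<in> F y \<and> u \<in> cball 0 1}"
    using SH3 compact_cball[of y0 1] unfolding SH3_def by meson
  define h where "h = min_hamiltonian F y0 e"
  have h: "h \<le> e \<bullet> w" if "w \<in> F y0" for w
  proof -
    have bdd: "bdd_below ((\<lambda>v. v \<bullet> e) ` F y0)"
    proof (rule bdd_belowI2)
      fix v assume "v \<in> F y0"
      then show "- M \<le> v \<bullet> e"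
        using M(2)[of y0 v] Cauchy_Schwarz_ineq2[of v e] e by auto
    qed
    then show ?thesis
      unfolding h_def min_hamiltonian_def using cINF_lower[OF bdd that] by (simp add: inner_commute[of e])
  qed
  \<comment> \<open>Radius at most 1 makes \<open>M\<close> and \<open>k\<close> available;
    \<open>k * \<delta> \<le> h / 2\<close> means that moving from \<open>y0\<close> to
    \<open>x\<close> costs the velocities at most half of the ascent \<open>h\<close>.\<close>
  define \<delta> where "\<delta> = min 1 (h / (2 * k))"
  have \<delta>: "0 < \<delta>" "\<delta> \<le> 1" "k * \<delta> \<le> h / 2"
  proof -
    show "0 < \<delta>" "\<delta> \<le> 1" using ham k by (auto simp: \<delta>_def h_def)
    have "k * \<delta> \<le> k * (h / (2 * k))" using k by (intro mult_left_mono) (auto simp: \<delta>_def)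
    then show "k * \<delta> \<le> h / 2" using k by simp
  qed
  let ?D = "cball y0 \<delta> \<times> cball (0::'a) M"
  have D: "compact ?D" "?D \<noteq> {}" "continuous_on ?D \<psi>"
    using \<delta> M \<psi> by (auto intro: compact_Times continuous_on_subset)
  obtain z1 where z1: "\<And>z. z \<in> ?D \<Longrightarrow> \<psi> z1 \<le> \<psi> z" using continuous_attains_inf[OF D] by auto
  obtain z2 where z2: "\<And>z. z \<in> ?D \<Longrightarrow> \<psi> z \<le> \<psi> z2" using continuous_attains_sup[OF D] by auto
  have "local_control_bounds F \<psi> Obs y0 e \<delta> M (h / 2) (\<psi> z1) (\<psi> z2)"
  proof
    fix x v assume x: "x \<in> cball y0 \<delta>"
    have x1: "x \<in> cball y0 1" using x \<delta> by auto
    show "norm v \<le> M" if "v \<in> F x" using M(2)[OF x1 that] .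
    show "\<psi> z1 \<le> \<psi> (x, v) \<and> \<psi> (x, v) \<le> \<psi> z2" if "norm v \<le> M"
      using z1[of "(x, v)"] z2[of "(x, v)"] x that by auto
    show "h / 2 \<le> e \<bullet> v" if v: "v \<in> F x"
    proof -
      obtain w u where w: "v = w + (k * norm (x - y0)) *\<^sub>R u" "w \<in> F y0" "norm u \<le> 1"
        using k(2)[OF x1, of y0] v by fastforce
      have "k * norm (x - y0) \<le> k * \<delta>"
        using x k(1) by (intro mult_left_mono) (auto simp: dist_norm norm_minus_commute)
      from order_trans[OF this \<delta>(3)] have "\<bar>k * norm (x - y0)\<bar> \<le> h / 2"
        using k(1) by simp
      then have "norm ((k * norm (x - y0)) *\<^sub>R u) \<le> (h / 2) * 1"
        using w(3) ham unfolding norm_scaleR h_def by (intro mult_mono) auto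
      then have "\<bar>e \<bullet> ((k * norm (x - y0)) *\<^sub>R u)\<bar> \<le> h / 2"
        using Cauchy_Schwarz_ineq2[of e "(k * norm (x - y0)) *\<^sub>R u"] e by simp
      then show ?thesis
        using h[OF w(2)] w(1) by (simp add: inner_add_right)
    qed
  qed (use \<delta> M \<psi> Obs e ham in \<open>auto simp: h_def\<close>)
  then show thesis by (rule that)
qed

text \<open>Lets the direction in \<open>H1\<close> be normalised. The infimum commutes with the
  scaling because this is monotone and continuous and the values are bounded below.\<close>

lemma min_hamiltonian_scaleR:
  assumes "0 < c" "SH1 F"
  shows "min_hamiltonian F y (c *\<^sub>R \<xi>) = c * min_hamiltonian F y \<xi>"
proof -
  obtain M where M: "\<And>v. v \<in> F y \<Longrightarrow> norm v \<le> M"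
    using assms(2) compact_sing[of y] unfolding SH1_def by (metis insertI1)
  have ne: "F y \<noteq> {}" using assms(2) by (simp add: SH1_def)
  have bdd: "bdd_below ((\<lambda>v. v \<bullet> \<xi>) ` F y)"
  proof (rule bdd_belowI2)
    fix v assume "v \<in> F y"
    then have "norm v * norm \<xi> \<le> M * norm \<xi>" using M by (intro mult_right_mono) auto
    then show "- (M * norm \<xi>) \<le> v \<bullet> \<xi>" using Cauchy_Schwarz_ineq2[of v \<xi>] by auto
  qed
  have "c * Inf ((\<lambda>v. v \<bullet> \<xi>) ` F y) = Inf ((*) c ` (\<lambda>v. v \<bullet> \<xi>) ` F y)"
    using assms(1) ne bdd
    by (intro continuous_at_Inf_mono) (auto intro!: monoI mult_left_mono continuous_intros)
  then show ?thesis
    by (simp add: min_hamiltonian_def image_image)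
qed

theorem theorem5p12:
  fixes F :: "'a::euclidean_space \<Rightarrow> 'a set"
    and \<psi> :: "'a \<times> 'a \<Rightarrow> real"
    and Obs :: "'a set"
    and y0 :: 'a
  assumes "SH1 F" and "SH2 F" and "SH3 F"
    and "continuous_on UNIV \<psi>" and "\<And>z. 0 < \<psi> z"
    and "closed Obs"
    and "y0 \<in> frontier Obs"
    and H1: "\<exists>\<xi>. \<exists>r>0. \<xi> \<noteq> 0 \<and> min_hamiltonian F y0 \<xi> > 0 \<and>
          ball (y0 + (r / norm \<xi>) *\<^sub>R \<xi>) r \<inter> frontier Obs \<subseteq> unreachable_boundary F \<psi> Obs"
    and H2: "\<exists>r0>0. \<forall>r. 0 < r \<and> r < r0 \<longrightarrow> connected (ball y0 r \<inter> - Obs)"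
    and "\<And>\<rho>. \<rho> > 0 \<Longrightarrow> forward_reach F \<psi> Obs \<rho> y0 \<inter> - Obs \<noteq> {}"
    and "\<And>\<rho>. \<rho> > 0 \<Longrightarrow> backward_reach F \<psi> Obs \<rho> y0 \<inter> - Obs \<noteq> {}"
  shows "envelope_generator F \<psi> Obs y0"
proof -
  obtain \<xi> r where r: "0 < r" and \<xi>: "\<xi> \<noteq> 0" "0 < min_hamiltonian F y0 \<xi>"
    and unreach: "ball (y0 + (r / norm \<xi>) *\<^sub>R \<xi>) r \<inter> frontier Obs \<subseteq> unreachable_boundary F \<psi> Obs"
    using H1 by blast
  define e where "e = (1 / norm \<xi>) *\<^sub>R \<xi>"
  have e: "norm e = 1" "r *\<^sub>R e = (r / norm \<xi>) *\<^sub>R \<xi>" using \<xi> by (auto simp: e_def)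
  have unreach': "ball (y0 + r *\<^sub>R e) r \<inter> frontier Obs \<subseteq> unreachable_boundary F \<psi> Obs"
    using unreach e(2) by simp
  have "0 < min_hamiltonian F y0 e"
    using \<xi> min_hamiltonian_scaleR[OF _ assms(1), of "1 / norm \<xi>" y0 \<xi>] by (simp add: e_def)
  then obtain \<delta> M \<eta> m P where "local_control_bounds F \<psi> Obs y0 e \<delta> M \<eta> m P"
    using local_control_bounds_exist[OF assms(1,3-6) e(1)] by blast
  then interpret local_control_bounds F \<psi> Obs y0 e \<delta> M \<eta> m P by simp
  obtain k where k: "0 < k" "\<And>x y. x \<in> cball y0 \<delta> \<Longrightarrow> y \<in> cball y0 \<delta> \<Longrightarrow>
      F x \<subseteq> {w + (k * norm (x - y)) *\<^sub>R u | w u. w \<in> F y \<and> u \<in> cball 0 1}"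
    using assms(3) compact_cball[of y0 \<delta>] unfolding SH3_def by meson
  have convex: "convex (F x)" for x using assms(1) by (simp add: SH1_def)
  have closed: "closed (F x)" for x
  proof -
    have "closed (Pair x -` {(x, v). v \<in> F x})"
      using assms(1) by (intro closed_vimage continuous_intros) (simp add: SH1_def)
    then show ?thesis by (simp add: vimage_def)
  qed
  have y0: "y0 \<in> Obs" using assms(6,7) frontier_subset_closed by blast
  obtain r0 where r0: "0 < r0" "\<And>r. 0 < r \<Longrightarrow> r < r0 \<Longrightarrow> connected (ball y0 r \<inter> - Obs)"
    using H2 by blast
  define a where "a = \<eta> / (2 * M)"
  define R where "R = min \<delta> (2 * r * a)"
  define \<rho>1 where "\<rho>1 = m * (R / (2 * M))"
  define C where "C = P * (2 * (a + 1) / \<eta>)"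
  have "0 < a" using pos by (simp add: a_def)
  then have posR: "0 < R" and posC: "0 < C" using pos r by (auto simp: R_def C_def)
  then have pos\<rho>: "0 < \<rho>1" using pos by (simp add: \<rho>1_def)
  \<comment> \<open>The three bounds ensure connectedness at all scales up to \<open>S\<close>, the
    range \<open>R / 2\<close> of the hitting estimate, and
    \<open>2 * (C * S) \<le> \<rho>1 / 2\<close>. All three persist for the scales
    \<open>S / Suc n\<close>.\<close>
  define S where "S = min (r0 / 2) (min (R / 2) (\<rho>1 / (4 * C)))"
  have S: "0 < S" "S < r0" "S \<le> R / 2" "S \<le> \<rho>1 / (4 * C)"
    using posR posC pos\<rho> r0(1) by (auto simp: S_def)
  have CS: "2 * (C * S) < \<rho>1"
    using S(4) posC pos\<rho> by (simp add: pos_le_divide_eq mult_ac)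
  have "\<exists>x\<in>wave_envelope F \<psi> Obs. x \<in> ball y0 (S / Suc n) \<and> rho_min F \<psi> Obs x \<le> ennreal (2 * (C * (S / Suc n)))" for n
  proof -
    have s: "0 < S / Suc n" "S / Suc n \<le> S"
      using S(1) by (auto simp: divide_le_eq mult_le_cancel_left1)
    have "2 * (C * (S / Suc n)) \<le> 2 * (C * S)"
      using s posC by (intro mult_left_mono) auto
    then have "2 * (C * (S / Suc n)) < \<rho>1" "S / Suc n \<le> R / 2" "S / Suc n < r0"
      using CS s(2) S(2,3) by linarith+
    then show ?thesis
      unfolding C_def a_def \<rho>1_def R_def
      by (intro envelope_point_near[OF convex closed k(1) _ r unreach' y0 assms(10,11) s(1)] k(2) r0(2) s(1))
  qed
  then obtain x where x: "\<And>n. x n \<in> wave_envelope F \<psi> Obs" "\<And>n. x n \<in> ball y0 (S / Suc n)"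
    "\<And>n. rho_min F \<psi> Obs (x n) \<le> ennreal (2 * (C * (S / Suc n)))"
    by metis
  have null: "(\<lambda>n. c / real (Suc n)) \<longlonglongrightarrow> 0" for c
    by (rule LIMSEQ_Suc[OF lim_const_over_n])
  have "x \<longlonglongrightarrow> y0"
  proof (rule Lim_transform_bound[THEN LIM_zero_cancel[where l = y0]])
    show "\<forall>\<^sub>F n in sequentially. norm (x n - y0) \<le> norm (S / Suc n)"
      using x(2) S(1) by (intro always_eventually allI) (simp add: dist_norm norm_minus_commute less_imp_le)
  qed (rule null)
  moreover have "(\<lambda>n. rho_min F \<psi> Obs (x n)) \<longlonglongrightarrow> 0"
  proof (rule tendsto_sandwich[OF _ _ tendsto_const])
    have "(\<lambda>n. ennreal (2 * (C * (S / Suc n)))) \<longlonglongrightarrow> ennreal (2 * (C * 0))"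
      by (intro tendsto_ennrealI tendsto_mult tendsto_const null)
    then show "(\<lambda>n. ennreal (2 * (C * (S / Suc n)))) \<longlonglongrightarrow> 0" by simp
  qed (use x(3) in auto)
  ultimately show ?thesis
    unfolding envelope_generator_def using assms(7) x(1) by blast
qed

end
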